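(* For all integers $k > t \geq 3$, \[ f(k,t) \leq \frac{R(k,k-t+1)-1}{t}. \]
   Context: All graphs are finite and simple. A graph $G$ is Ramsey for $H$ if every red/blue colouring of the edges of $G$ contains a monochromatic copy of $H$. Two graphs $H,H'$ are Ramsey-equivalent if every graph $G$ is Ramsey for $H$ if and only if it is Ramsey for $H'$. $K_k + f\cdot K_t$ denotes the disjoint union of one copy of $K_k$ and $f$ copies of $K_t$. $f(k,t)$ is the maximum integer $f \geq 0$ such that $K_k$ and $K_k + f\cdot K_t$ are Ramsey-equivalent. $R(k,s)$ is the Ramsey number: the minimum $n$ such that every red/blue edge-colouring of $K_n$ contains a red $K_k$ or a blue $K_s$. *)

theory Defs
  imports Complex_Main "HOL-Library.Ramsey"
begin

type_synonym 'a graph = "'a set \<times> 'a set set"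

abbreviation verts :: "'a graph \<Rightarrow> 'a set" where "verts \<equiv> fst"
abbreviation edges :: "'a graph \<Rightarrow> 'a set set" where "edges \<equiv> snd"

definition simple_graph :: "'a graph \<Rightarrow> bool" where
  "simple_graph G \<longleftrightarrow> finite (verts G) \<and> edges G \<subseteq> nsets (verts G) 2"

definition complete_graph :: "nat \<Rightarrow> nat graph" where
  "complete_graph n = ({..<n}, nsets {..<n} 2)"

definition disjoint_union :: "'a graph \<Rightarrow> 'b graph \<Rightarrow> ('a + 'b) graph" where
  "disjoint_union G H =
     (verts G <+> verts H, (`) Inl ` edges G \<union> (`) Inr ` edges H)"

definition copies :: "nat \<Rightarrow> 'a graph \<Rightarrow> (nat \<times> 'a) graph" where
  "copies m G = ({..<m} \<times> verts G, (\<Union>i<m. (`) (Pair i) ` edges G))"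

(* A copy is a subgraph, not necessarily an induced one. The two colours are
   the two truth values; values of c on non-edges of G are irrelevant. *)
definition has_mono_copy :: "'a graph \<Rightarrow> ('a set \<Rightarrow> bool) \<Rightarrow> 'b graph \<Rightarrow> bool" where
  "has_mono_copy G c H \<longleftrightarrow>
     (\<exists>colour \<phi>. inj_on \<phi> (verts H) \<and> \<phi> ` verts H \<subseteq> verts G \<and>
        (\<forall>e \<in> edges H. \<phi> ` e \<in> edges G \<and> c (\<phi> ` e) = colour))"

definition ramsey_for :: "'a graph \<Rightarrow> 'b graph \<Rightarrow> bool" where
  "ramsey_for G H \<longleftrightarrow> (\<forall>c. has_mono_copy G c H)"

(* Being Ramsey for a given graph is invariant under isomorphism, and every finite
   graph is isomorphic to one whose vertices are natural numbers, so quantifying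
   over the type nat graph covers all finite simple graphs. *)
definition ramsey_equivalent :: "'a graph \<Rightarrow> 'b graph \<Rightarrow> bool" where
  "ramsey_equivalent H H' \<longleftrightarrow>
     (\<forall>G :: nat graph. simple_graph G \<longrightarrow> (ramsey_for G H \<longleftrightarrow> ramsey_for G H'))"

(* If no maximum existed, GREATEST would be an unspecified number about which no
   upper bound could be proved, so a bound on this value also needs the maximum
   to exist. *)
definition max_ramsey_copies :: "nat \<Rightarrow> nat \<Rightarrow> nat" where
  "max_ramsey_copies k t =
     (GREATEST m. ramsey_equivalent (complete_graph k)
        (disjoint_union (complete_graph k) (copies m (complete_graph t))))"

definition ramsey_number :: "nat \<Rightarrow> nat \<Rightarrow> nat" where
  "ramsey_number k s = (LEAST n. partn_lst {..<n} [k, s] 2)"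

lemma ramsey_number_partn: "partn_lst {..<ramsey_number k s} [k, s] 2"
  unfolding ramsey_number_def by (rule LeastI_ex) (rule ramsey_full)

lemma has_mono_copy_zero_copies:
  fixes G :: "'a graph" and H :: "'b graph" and K :: "'c graph"
  shows "has_mono_copy G c (disjoint_union H (copies 0 K)) \<longleftrightarrow> has_mono_copy G c H"
proof -
  let ?P = "\<lambda>colour \<phi>. inj_on \<phi> (verts H) \<and> \<phi> ` verts H \<subseteq> verts G \<and>
        (\<forall>e \<in> edges H. \<phi> ` e \<in> edges G \<and> c (\<phi> ` e) = colour)"
  have "has_mono_copy G c (disjoint_union H (copies 0 K)) \<longleftrightarrow>
      (\<exists>colour (\<phi> :: 'b + nat \<times> 'c \<Rightarrow> 'a). ?P colour (\<lambda>x. \<phi> (Inl x)))"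
    by (simp add: has_mono_copy_def disjoint_union_def copies_def Plus_def image_image inj_on_def)
  also have "\<dots> \<longleftrightarrow> has_mono_copy G c H"
  proof
    assume "has_mono_copy G c H"
    then obtain colour \<phi> where "?P colour \<phi>"
      unfolding has_mono_copy_def by blast
    then have "?P colour (\<lambda>x. case_sum \<phi> undefined (Inl x))"
      by simp
    then show "\<exists>colour (\<phi> :: 'b + nat \<times> 'c \<Rightarrow> 'a). ?P colour (\<lambda>x. \<phi> (Inl x))"
      by (intro exI)
  next
    assume "\<exists>colour (\<phi> :: 'b + nat \<times> 'c \<Rightarrow> 'a). ?P colour (\<lambda>x. \<phi> (Inl x))"
    then obtain colour and \<phi> :: "'b + nat \<times> 'c \<Rightarrow> 'a" where "?P colour (\<lambda>x. \<phi> (Inl x))"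
      by (elim exE)
    then show "has_mono_copy G c H"
      unfolding has_mono_copy_def by (intro exI)
  qed
  finally show ?thesis .
qed

lemma ramsey_equivalent_zero_copies:
  "ramsey_equivalent H (disjoint_union H (copies 0 K))"
  by (simp add: ramsey_equivalent_def ramsey_for_def has_mono_copy_zero_copies)

end

theory Submission
  imports Defs
begin

text \<open>
  Edge colours are truth values, \<open>True\<close> being red. Let \<open>R = R(k, k - t + 1)\<close> and \<open>m t \<ge> R\<close>. Join a
  clique \<open>S\<close> on \<open>R + k - 1\<close> vertices, coloured red, by blue edges to a graph \<open>Q\<close> coloured without red
  \<open>K\<^sub>t\<close> and without blue \<open>K\<close> on \<open>k - 1\<close> vertices. There is no blue \<open>K\<^sub>k\<close>, and all red \<open>K\<^sub>t\<close> lie in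
  \<open>S\<close>, which is too small for \<open>K\<^sub>k + m K\<^sub>t\<close>.

  The graph is Ramsey for \<open>K\<^sub>k\<close> if \<open>Q\<close> is chosen well. Vertex-Ramsey closure lets us assume that every
  \<open>s \<in> S\<close> sends one colour to a copy in \<open>Q\<close> of two graphs. The first is a Folkman graph of clique number
  \<open>k - 2\<close> in which every colouring has a monochromatic, say blue, clique of that size; then the vertices
  of \<open>S\<close> that are blue to the copy span only red edges, so there are fewer than \<open>k\<close> of them, and at
  least \<open>R\<close> vertices of \<open>S\<close> are red to it. Those contain a red clique of size \<open>k - t + 1\<close> (or a blue
  \<open>K\<^sub>k\<close>). The second is a graph each of whose colourings has a red clique of size \<open>t - 1\<close> or a blue
  \<open>K\<^sub>k\<close>, which completes a red \<open>K\<^sub>k\<close>.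

  The second graph is built by the same trick, inductively, joining a \<open>K\<close> on \<open>k - 2\<close> vertices to the
  closure of the previous graph. The Folkman graph comes from the partite construction of
  Nesetril and Rodl.
\<close>

subsection \<open>Amalgamation\<close>

text \<open>\<open>E\<close> is the colouring that we exhibit, with small cliques. The colourings that the graph has to
  arrow are functions on vertex sets, unrelated to \<open>E\<close>.\<close>
definition two_graph :: "(bool \<Rightarrow> nat) \<Rightarrow> 'a set \<Rightarrow> (bool \<Rightarrow> 'a set set) \<Rightarrow> bool" where
  "two_graph w V E \<longleftrightarrow> finite V \<and> (\<forall>d. E d \<subseteq> nsets V 2) \<and>
     (\<forall>d C. C \<subseteq> V \<longrightarrow> clique C (E d) \<longrightarrow> card C \<le> w d)"

text \<open>Non-edges may be mapped to edges: copies only carry monochromatic cliques forward, and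
  for this the images of edges suffice.\<close>

definition emb :: "'a set \<Rightarrow> (bool \<Rightarrow> 'a set set) \<Rightarrow> 'b set \<Rightarrow> (bool \<Rightarrow> 'b set set) \<Rightarrow> ('a \<Rightarrow> 'b) \<Rightarrow> bool" where
  "emb V E V' E' g \<longleftrightarrow> inj_on g V \<and> g ` V \<subseteq> V' \<and> (\<forall>d. \<forall>e\<in>E d. g ` e \<in> E' d)"

text \<open>\<open>\<pi>\<close> numbers the parts, which are independent sets. The number of parts
  is left open, so \<open>id\<close> makes every graph partite.\<close>

definition partite :: "(bool \<Rightarrow> 'a set set) \<Rightarrow> ('a \<Rightarrow> nat) \<Rightarrow> bool" where
  "partite E \<pi> \<longleftrightarrow> (\<forall>d. \<forall>e\<in>E d. inj_on \<pi> e)"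

definition pemb where
  "pemb V E \<pi> V' E' \<pi>' g \<longleftrightarrow> emb V E V' E' g \<and> (\<forall>x\<in>V. \<pi>' (g x) = \<pi> x)"

lemma cliqueI: "(\<And>x y. x \<in> C \<Longrightarrow> y \<in> C \<Longrightarrow> x \<noteq> y \<Longrightarrow> {x, y} \<in> F) \<Longrightarrow> clique C F"
  by (simp add: clique_def)

lemma cliqueD: "clique C F \<Longrightarrow> x \<in> C \<Longrightarrow> y \<in> C \<Longrightarrow> x \<noteq> y \<Longrightarrow> {x, y} \<in> F"
  by (simp add: clique_def)

lemma two_graphD:
  assumes "two_graph w V E"
  shows "finite V" "E d \<subseteq> nsets V 2" "C \<subseteq> V \<Longrightarrow> clique C (E d) \<Longrightarrow> card C \<le> w d"
  using assms unfolding two_graph_def by blast+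

lemma two_graph_edgeD:
  assumes "two_graph w V E" "{x, y} \<in> E d"
  shows "x \<in> V" "y \<in> V" "x \<noteq> y"
  using subsetD[OF two_graphD(2)[OF assms(1)] assms(2)] by simp_all

lemma two_graph_mono:
  "two_graph w V E \<Longrightarrow> (\<And>d. w d \<le> w' d) \<Longrightarrow> two_graph w' V E"
  unfolding two_graph_def by (meson le_trans)

lemma emb_image: "emb V E V' E' g \<Longrightarrow> e \<in> E d \<Longrightarrow> g ` e \<in> E' d"
  by (simp add: emb_def)

lemma emb_comp:
  assumes "emb V E V' E' g" "emb V' E' V'' E'' h"
  shows "emb V E V'' E'' (h \<circ> g)"
  unfolding emb_def
proof (intro conjI allI ballI)
  show "inj_on (h \<circ> g) V"
    using assms unfolding emb_def by (meson comp_inj_on inj_on_subset)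
  show "(h \<circ> g) ` V \<subseteq> V''"
    using assms unfolding emb_def image_comp[symmetric] by (meson image_mono order_trans)
  fix d e assume "e \<in> E d"
  then have "g ` e \<in> E' d" by (rule emb_image[OF assms(1)])
  then have "h ` g ` e \<in> E'' d" by (rule emb_image[OF assms(2)])
  then show "(h \<circ> g) ` e \<in> E'' d" by (simp add: image_comp)
qed

lemma emb_in: "emb V E V' E' g \<Longrightarrow> x \<in> V \<Longrightarrow> g x \<in> V'"
  unfolding emb_def by blast

lemma emb_edge:
  assumes "emb V E V' E' g" "{x, y} \<in> E d"
  shows "{g x, g y} \<in> E' d"
proof -
  have "g ` {x, y} \<in> E' d" using emb_image[OF assms] .
  then show ?thesis by simp
qed

lemma partiteD: "partite E \<pi> \<Longrightarrow> e \<in> E d \<Longrightarrow> inj_on \<pi> e"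
  by (simp add: partite_def)

lemma partite_edge: "partite E \<pi> \<Longrightarrow> {x, y} \<in> E d \<Longrightarrow> x \<noteq> y \<Longrightarrow> \<pi> x \<noteq> \<pi> y"
  by (drule (1) partiteD) (simp add: inj_on_def)

lemma partite_clique: "partite E \<pi> \<Longrightarrow> clique C (E d) \<Longrightarrow> inj_on \<pi> C"
  by (metis cliqueD inj_onI partite_edge)

lemma pemb_comp:
  "pemb V E \<pi> V' E' \<pi>' g \<Longrightarrow> pemb V' E' \<pi>' V'' E'' \<pi>'' h \<Longrightarrow> pemb V E \<pi> V'' E'' \<pi>'' (h \<circ> g)"
  unfolding pemb_def by (auto intro: emb_comp dest: emb_in)

text \<open>Glued graphs live on sum types. Transporting them to natural numbers lets the
  constructions be iterated on one type of vertices.\<close>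

lemma relabel:
  fixes V :: "'a set"
  assumes G: "two_graph w V E" and h: "inj_on h V"
  shows "two_graph w (h ` V) (\<lambda>d. (`) h ` E d)" "emb V E (h ` V) (\<lambda>d. (`) h ` E d) h"
    and "partite E \<pi> \<Longrightarrow> partite (\<lambda>d. (`) h ` E d) (\<pi> \<circ> inv_into V h)"
proof -
  have sub: "e \<subseteq> V" if "e \<in> E d" for e d
    using two_graphD(2)[OF G, of d] that by (auto simp: nsets_def)
  have edge: "{x, y} \<in> E d" if hxy: "{h x, h y} \<in> (`) h ` E d" and xy: "x \<in> V" "y \<in> V" for x y d
  proof -
    obtain e where e: "e \<in> E d" "{h x, h y} = h ` e" using hxy by blast
    then have "h ` {x, y} = h ` e" by simp
    then have "{x, y} = e" using inj_on_image_eq_iff[OF h, of "{x, y}" e] sub[OF e(1)] xy by simp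
    then show ?thesis using e by simp
  qed
  have "(`) h ` E d \<subseteq> nsets (h ` V) 2" for d
  proof
    fix e assume "e \<in> (`) h ` E d"
    then obtain e0 where e0: "e0 \<in> E d" "e = h ` e0" by blast
    from subsetD[OF two_graphD(2)[OF G] e0(1)] show "e \<in> nsets (h ` V) 2"
      by (rule nsets2_E) (use h e0(2) in \<open>simp add: inj_on_eq_iff\<close>)
  qed
  moreover have "card C \<le> w d" if C: "C \<subseteq> h ` V" "clique C ((`) h ` E d)" for C d
  proof -
    obtain C0 where C0: "C0 \<subseteq> V" "C = h ` C0" using C(1) by (rule subset_imageE)
    have "clique C0 (E d)"
    proof (rule cliqueI)
      fix v u assume "v \<in> C0" "u \<in> C0" "v \<noteq> u"
      moreover from this have "h v \<noteq> h u" using inj_on_subset[OF h C0(1)] by (simp add: inj_on_eq_iff)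
      ultimately show "{v, u} \<in> E d" using cliqueD[OF C(2), of "h v" "h u"] C0 edge[of v u] by blast
    qed
    then have "card C0 \<le> w d" using two_graphD(3)[OF G C0(1)] by blast
    then show ?thesis unfolding C0(2) using card_image_le[OF finite_subset[OF C0(1) two_graphD(1)[OF G]], of h] by linarith
  qed
  ultimately show "two_graph w (h ` V) (\<lambda>d. (`) h ` E d)"
    using two_graphD(1)[OF G] unfolding two_graph_def by blast
  show "emb V E (h ` V) (\<lambda>d. (`) h ` E d) h"
    using h by (auto simp: emb_def)
  show "partite (\<lambda>d. (`) h ` E d) (\<pi> \<circ> inv_into V h)" if "partite E \<pi>"
    unfolding partite_def
  proof (intro allI ballI)
    fix d e assume "e \<in> (`) h ` E d"
    then obtain e0 where e0: "e0 \<in> E d" "e = h ` e0" by blast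
    have "inj_on \<pi> e0" by (rule partiteD[OF that e0(1)])
    then show "inj_on (\<pi> \<circ> inv_into V h) e"
      using sub[OF e0(1)] inv_into_f_f[OF h] unfolding e0(2) inj_on_def by (auto simp: subset_iff)
  qed
qed

text \<open>Take one copy of \<open>(V, E)\<close> for each \<open>i\<close> and glue its part \<open>D\<close> into \<open>D'\<close> along \<open>f i\<close>. Vertices of
  different copies outside \<open>D'\<close> are not adjacent, so a clique lies in one copy or in \<open>D'\<close>.\<close>
lemma amalgamation:
  fixes V :: "'a set" and D' :: "'b set" and I :: "'i set"
  assumes G: "two_graph w V E" and D: "D \<subseteq> V" and G0: "two_graph w D' E0" and \<pi>0: "partite E0 \<pi>0"
    and I: "finite I"
    and f: "\<forall>i\<in>I. inj_on (f i) D \<and> f i ` D \<subseteq> D' \<and> partite E (p i) \<and> (\<forall>x\<in>D. \<pi>0 (f i x) = p i x) \<and>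
      (\<forall>d. \<forall>x\<in>D. \<forall>y\<in>D. {x, y} \<in> E d \<longleftrightarrow> {f i x, f i y} \<in> E0 d)"
  obtains V' :: "nat set" and E' \<pi>' \<iota> g where "two_graph w V' E'" "partite E' \<pi>'" "emb D' E0 V' E' \<iota>"
    "\<forall>i\<in>I. pemb V E (p i) V' E' \<pi>' (g i) \<and> (\<forall>x\<in>D. g i x = \<iota> (f i x))"
proof -
  have inj: "inj_on (f i) D" and into: "f i ` D \<subseteq> D'" and p: "partite E (p i)"
    and pf: "\<And>x. x \<in> D \<Longrightarrow> \<pi>0 (f i x) = p i x"
    and ind: "\<And>d x y. x \<in> D \<Longrightarrow> y \<in> D \<Longrightarrow> {x, y} \<in> E d \<longleftrightarrow> {f i x, f i y} \<in> E0 d" if "i \<in> I" for i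
    using f that by simp_all
  define V1 :: "('b + 'i \<times> 'a) set" where "V1 = Inl ` D' \<union> Inr ` (I \<times> (V - D))"
  \<comment> \<open>Copy \<open>i\<close> keeps its vertices outside \<open>D\<close> private,
    tagged with \<open>i\<close>; those in \<open>D\<close> are identified with their images in
    \<open>D'\<close>.\<close>
  define g where "g i x = (if x \<in> D then Inl (f i x) else Inr (i, x))" for i x
  define E1 where "E1 d = (`) Inl ` E0 d \<union> (\<Union>i\<in>I. (`) (g i) ` E d)" for d
  define \<pi>1 where "\<pi>1 z = (case z of Inl y \<Rightarrow> \<pi>0 y | Inr (i, u) \<Rightarrow> p i u)" for z
  have Esub: "\<exists>x y. e = {x, y} \<and> x \<in> V \<and> y \<in> V \<and> x \<noteq> y" if "e \<in> E d" for e d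
    using two_graphD(2)[OF G, of d] that nsets2_E by (metis subsetD)
  have E0sub: "\<exists>x y. e = {x, y} \<and> x \<in> D' \<and> y \<in> D' \<and> x \<noteq> y" if "e \<in> E0 d" for e d
    using two_graphD(2)[OF G0, of d] that nsets2_E by (metis subsetD)
  have ginj: "inj_on (g i) V" if "i \<in> I" for i
    using inj[OF that] by (auto simp: g_def inj_on_def)
  have gV: "g i x \<in> V1" if "i \<in> I" "x \<in> V" for i x
    using into[OF that(1)] that by (auto simp: g_def V1_def)
  \<comment> \<open>Gluing adds no edge within \<open>D'\<close>, because \<open>f i\<close>
    reflects edges as well as preserving them.\<close>
  have LA: "{x, y} \<in> E0 d" if xy: "{Inl x, Inl y} \<in> E1 d" for x y d
  proof -
    consider e where "e \<in> E0 d" "{Inl x, Inl y} = (Inl ` e :: ('b + 'i \<times> 'a) set)"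
      | i e where "i \<in> I" "e \<in> E d" "{Inl x, Inl y} = g i ` e"
      using xy unfolding E1_def by blast
    then show ?thesis
    proof cases
      case 1
      have "Inl ` {x, y} = (Inl ` e :: ('b + 'i \<times> 'a) set)" using 1(2) by simp
      then have "{x, y} = e" by (metis inj_Inl inj_image_eq_iff)
      then show ?thesis using 1 by simp
    next
      case 2
      obtain u v where uv: "e = {u, v}" using Esub[OF 2(2)] by blast
      have eq: "{Inl x, Inl y} = {g i u, g i v}" using 2(3) uv by simp
      have "u \<in> D" "v \<in> D" using eq by (auto simp: g_def doubleton_eq_iff split: if_splits)
      then have "{x, y} = {f i u, f i v}" using eq by (auto simp: g_def doubleton_eq_iff)
      then show ?thesis using ind[OF 2(1) \<open>u \<in> D\<close> \<open>v \<in> D\<close>] 2(2) uv by simp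
    qed
  qed
  \<comment> \<open>The tags differ between copies, so no other copy contributes an edge at a
    private vertex of copy \<open>i\<close>.\<close>
  have LB: "\<exists>e\<in>E d. {Inr (i, u), z} = g i ` e" if iuz: "{Inr (i, u), z} \<in> E1 d" for i u z d
  proof -
    have "{Inr (i, u), z} \<notin> (`) Inl ` E0 d" by auto
    then obtain j e where je: "j \<in> I" "e \<in> E d" "{Inr (i, u), z} = g j ` e"
      using iuz unfolding E1_def by blast
    then have "Inr (i, u) \<in> g j ` e" by blast
    then have "j = i" by (auto simp: g_def split: if_splits)
    then show ?thesis using je by blast
  qed
  \<comment> \<open>Each copy is induced in the glued graph, so that cliques inside a copy pull back
    to \<open>V\<close>. Pairs within \<open>D\<close> need \<open>LA\<close>; any other edge comes
    from copy \<open>i\<close> itself.\<close>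
  have LC: "{x, y} \<in> E d" if i: "i \<in> I" and xy: "x \<in> V" "y \<in> V" and e: "{g i x, g i y} \<in> E1 d" for i x y d
  proof -
    have out: "{x, y} \<in> E d" if "x \<notin> D" "x \<in> V" "y \<in> V" "{g i x, g i y} \<in> E1 d" for x y
    proof -
      have "{Inr (i, x), g i y} \<in> E1 d" using that by (simp add: g_def)
      then obtain e where e: "e \<in> E d" "{Inr (i, x), g i y} = g i ` e" using LB by blast
      have "g i x = Inr (i, x)" using that(1) by (simp add: g_def)
      then have "g i ` {x, y} = g i ` e" using e(2) by simp
      moreover have "e \<subseteq> V" using Esub[OF e(1)] by blast
      ultimately have "{x, y} = e"
        using inj_on_image_eq_iff[OF ginj[OF i], of "{x, y}" e] that by simp
      then show ?thesis using e by simp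
    qed
    show ?thesis
    proof (cases "x \<in> D \<and> y \<in> D")
      case True
      then have "{f i x, f i y} \<in> E0 d" using e LA by (simp add: g_def)
      then show ?thesis using ind[OF i] True by blast
    next
      case False
      then show ?thesis using out[of x y] out[of y x] xy e by (auto simp: insert_commute)
    qed
  qed
  have fin: "finite V1"
    using two_graphD(1)[OF G] two_graphD(1)[OF G0] I by (simp add: V1_def)
  have "e \<in> nsets V1 2" if "e \<in> E1 d" for e d
    using that unfolding E1_def
  proof
    assume "e \<in> (`) Inl ` E0 d"
    then obtain e0 where e0: "e0 \<in> E0 d" "e = Inl ` e0" by blast
    then show ?thesis using E0sub[OF e0(1)] by (auto simp: V1_def)
  next
    assume "e \<in> (\<Union>i\<in>I. (`) (g i) ` E d)"
    then obtain i e0 where e0: "i \<in> I" "e0 \<in> E d" "e = g i ` e0" by blast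
    obtain x y where "e0 = {x, y}" "x \<in> V" "y \<in> V" "x \<noteq> y" using Esub[OF e0(2)] by blast
    then show ?thesis using e0 gV ginj[OF e0(1)] by (auto simp: inj_on_def)
  qed
  moreover have "card C \<le> w d" if C: "C \<subseteq> V1" "clique C (E1 d)" for C d
  proof (cases "C \<subseteq> Inl ` D'")
    case True
    then obtain C0 where C0: "C0 \<subseteq> D'" "C = Inl ` C0" by (meson subset_imageE)
    have "clique C0 (E0 d)" using cliqueD[OF C(2)] C0(2) LA by (intro cliqueI) blast
    then have "card C0 \<le> w d" using two_graphD(3)[OF G0 C0(1)] by blast
    then show ?thesis unfolding C0(2) by (simp add: card_image)
  next
    case False
    then obtain z where z: "z \<in> C" "z \<notin> Inl ` D'" by blast
    then have "z \<in> Inr ` (I \<times> (V - D))" using C(1) by (auto simp: V1_def)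
    with z obtain i u where iu: "i \<in> I" "u \<in> V" "u \<notin> D" "Inr (i, u) \<in> C" by blast
    have "z \<in> g i ` V" if "z \<in> C" for z
    proof (cases "z = Inr (i, u)")
      case True
      then show ?thesis using iu by (auto simp: g_def image_iff)
    next
      case False
      then have "{Inr (i, u), z} \<in> E1 d" using cliqueD[OF C(2)] iu that by auto
      then obtain e where "e \<in> E d" "{Inr (i, u), z} = g i ` e" using LB by blast
      then show ?thesis using Esub by blast
    qed
    then obtain C0 where C0: "C0 \<subseteq> V" "C = g i ` C0" by (meson subsetI subset_imageE)
    have "clique C0 (E d)"
    proof (rule cliqueI)
      fix x y assume xy: "x \<in> C0" "y \<in> C0" "x \<noteq> y"
      then have "g i x \<noteq> g i y" using inj_on_subset[OF ginj[OF iu(1)] C0(1)] by (simp add: inj_on_eq_iff)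
      then show "{x, y} \<in> E d" using LC[OF iu(1)] xy C0 cliqueD[OF C(2)] by blast
    qed
    then have "card C0 \<le> w d" using two_graphD(3)[OF G C0(1)] by blast
    then show ?thesis unfolding C0(2)
      using card_image_le[OF finite_subset[OF C0(1) two_graphD(1)[OF G]], of "g i"] by linarith
  qed
  ultimately have G1: "two_graph w V1 E1" using fin unfolding two_graph_def by blast
  have \<pi>g: "\<pi>1 (g i x) = p i x" if "i \<in> I" for i x
    using pf[OF that] by (simp add: \<pi>1_def g_def)
  have part: "partite E1 \<pi>1"
    unfolding partite_def E1_def
  proof (intro allI ballI, elim UnE)
    fix d and e :: "('b + 'i \<times> 'a) set" assume "e \<in> (`) Inl ` E0 d"
    then obtain e0 where "e0 \<in> E0 d" "e = Inl ` e0" by blast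
    with partiteD[OF \<pi>0 this(1)] show "inj_on \<pi>1 e" by (auto simp: \<pi>1_def inj_on_def)
  next
    fix d e assume "e \<in> (\<Union>i\<in>I. (`) (g i) ` E d)"
    then obtain i e0 where e0: "i \<in> I" "e0 \<in> E d" "e = g i ` e0" by blast
    then have "inj_on (p i) e0" using partiteD[OF p[OF e0(1)]] by simp
    then show "inj_on \<pi>1 e" using e0 \<pi>g by (auto simp: inj_on_def)
  qed
  obtain h :: "'b + 'i \<times> 'a \<Rightarrow> nat" where h: "inj_on h V1"
    using finite_imp_inj_to_nat_seg[OF fin] by blast
  let ?V = "h ` V1" and ?E = "\<lambda>d. (`) h ` E1 d"
  have "emb D' E0 V1 E1 Inl" by (auto simp: emb_def V1_def E1_def)
  then have "emb D' E0 ?V ?E (h \<circ> Inl)" by (rule emb_comp[OF _ relabel(2)[OF G1 h]])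
  moreover have "pemb V E (p i) ?V ?E (\<pi>1 \<circ> inv_into V1 h) (h \<circ> g i) \<and>
      (\<forall>x\<in>D. (h \<circ> g i) x = (h \<circ> Inl) (f i x))" if i: "i \<in> I" for i
  proof -
    have "g i ` e \<in> E1 d" if "e \<in> E d" for e d
      unfolding E1_def using i that by blast
    then have "emb V E V1 E1 (g i)" using ginj[OF i] gV[OF i] by (auto simp: emb_def)
    then have "emb V E ?V ?E (h \<circ> g i)" by (rule emb_comp[OF _ relabel(2)[OF G1 h]])
    then show ?thesis
      using \<pi>g[OF i] gV[OF i] inv_into_f_f[OF h] by (simp add: pemb_def) (simp add: g_def)
  qed
  ultimately show ?thesis
    by (intro that[OF relabel(1)[OF G1 h] relabel(3)[OF G1 h part], of "h \<circ> Inl" "\<lambda>i. h \<circ> g i"]) simp_all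
qed

subsection \<open>Homogeneous copies\<close>

text \<open>A colouring \<open>\<chi>\<close> colours both the vertices, seen as singletons, and the edges.\<close>
definition realizable ::
  "(bool \<Rightarrow> nat) \<Rightarrow> 'c set \<Rightarrow> nat set \<Rightarrow> (bool \<Rightarrow> nat set set) \<Rightarrow> (nat \<Rightarrow> nat) \<Rightarrow> ((nat set \<Rightarrow> 'c) \<Rightarrow> bool) \<Rightarrow> bool" where
  "realizable w K V E \<pi> \<Phi> \<longleftrightarrow> (\<exists>(V' :: nat set) E' \<pi>'. two_graph w V' E' \<and> partite E' \<pi>' \<and>
     (\<forall>\<chi>. (\<forall>e. \<chi> e \<in> K) \<longrightarrow> (\<exists>g. pemb V E \<pi> V' E' \<pi>' g \<and> \<Phi> (\<lambda>e. \<chi> (g ` e)))))"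

lemma realizableI:
  assumes "two_graph w (V' :: nat set) E'" "partite E' \<pi>'"
    and "\<And>\<chi>. (\<And>e. \<chi> e \<in> K) \<Longrightarrow> \<exists>g. pemb V E \<pi> V' E' \<pi>' g \<and> \<Phi> (\<lambda>e. \<chi> (g ` e))"
  shows "realizable w K V E \<pi> \<Phi>"
  unfolding realizable_def
  by (rule exI[of _ V'], rule exI[of _ E'], rule exI[of _ \<pi>'], intro conjI allI impI assms) simp

lemma realizableE:
  assumes "realizable w K V E \<pi> \<Phi>"
  obtains V' :: "nat set" and E' \<pi>' where "two_graph w V' E'" "partite E' \<pi>'"
    "\<forall>\<chi>. (\<forall>e. \<chi> e \<in> K) \<longrightarrow> (\<exists>g. pemb V E \<pi> V' E' \<pi>' g \<and> \<Phi> (\<lambda>e. \<chi> (g ` e)))"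
  using assms unfolding realizable_def by (elim exE conjE)

text \<open>The requirements are met one at a time, each new graph being built over the previous
  one. A colouring is treated in the opposite order: \<open>\<tau>\<close> is secured first, then
  the requirements in \<open>T\<close> inside the copy found; by \<open>pull\<close>, the condition
  for \<open>\<tau>\<close> survives the passage to the smaller copy.\<close>

lemma realizable_Ball:
  fixes H :: "'t \<Rightarrow> nat set \<Rightarrow> (bool \<Rightarrow> nat set set) \<Rightarrow> (nat \<Rightarrow> nat) \<Rightarrow> (nat set \<Rightarrow> 'c) \<Rightarrow> bool"
  assumes T: "finite T"
    and step: "\<And>\<tau> V E \<pi>. \<tau> \<in> T \<Longrightarrow> two_graph w V E \<Longrightarrow> partite E \<pi> \<Longrightarrow> realizable w K V E \<pi> (H \<tau> V E \<pi>)"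
    and pull: "\<And>\<tau> V E \<pi> V' E' \<pi>' g \<chi>. pemb V E \<pi> V' E' \<pi>' g \<Longrightarrow> H \<tau> V' E' \<pi>' \<chi> \<Longrightarrow>
      H \<tau> V E \<pi> (\<lambda>e. \<chi> (g ` e))"
    and G: "two_graph w V E" "partite E \<pi>"
  shows "realizable w K V E \<pi> (\<lambda>\<chi>. \<forall>\<tau>\<in>T. H \<tau> V E \<pi> \<chi>)"
  using T step
proof (induction T rule: finite_induct)
  case empty
  have "pemb V E \<pi> V E \<pi> id" by (simp add: pemb_def emb_def)
  then show ?case by (intro realizableI[OF G] exI[of _ id]) simp
next
  case (insert \<tau> T)
  have "realizable w K V E \<pi> (\<lambda>\<chi>. \<forall>\<tau>\<in>T. H \<tau> V E \<pi> \<chi>)"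
    by (rule insert.IH) (simp add: insert.prems)
  then obtain V1 :: "nat set" and E1 \<pi>1 where 1: "two_graph w V1 E1" "partite E1 \<pi>1"
    and hom1: "\<forall>\<chi>. (\<forall>e. \<chi> e \<in> K) \<longrightarrow>
        (\<exists>g. pemb V E \<pi> V1 E1 \<pi>1 g \<and> (\<forall>\<tau>\<in>T. H \<tau> V E \<pi> (\<lambda>e. \<chi> (g ` e))))"
    by (rule realizableE)
  obtain V2 :: "nat set" and E2 \<pi>2 where 2: "two_graph w V2 E2" "partite E2 \<pi>2"
    and hom2: "\<forall>\<chi>. (\<forall>e. \<chi> e \<in> K) \<longrightarrow>
        (\<exists>g. pemb V1 E1 \<pi>1 V2 E2 \<pi>2 g \<and> H \<tau> V1 E1 \<pi>1 (\<lambda>e. \<chi> (g ` e)))"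
    using insert.prems[OF insertI1 1] by (rule realizableE)
  show ?case
  proof (rule realizableI[OF 2])
    fix \<chi> :: "nat set \<Rightarrow> 'c" assume \<chi>: "\<And>e. \<chi> e \<in> K"
    obtain g2 where g2: "pemb V1 E1 \<pi>1 V2 E2 \<pi>2 g2" "H \<tau> V1 E1 \<pi>1 (\<lambda>e. \<chi> (g2 ` e))"
      using hom2[rule_format, of \<chi>] \<chi> by auto
    obtain g1 where g1: "pemb V E \<pi> V1 E1 \<pi>1 g1" "\<forall>\<tau>\<in>T. H \<tau> V E \<pi> (\<lambda>e. \<chi> (g2 ` (g1 ` e)))"
      using hom1[rule_format, of "\<lambda>e. \<chi> (g2 ` e)"] \<chi> by auto
    have "H \<tau> V E \<pi> (\<lambda>e. \<chi> (g2 ` (g1 ` e)))" using pull[OF g1(1) g2(2)] .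
    then have "\<forall>\<tau>\<in>insert \<tau> T. H \<tau> V E \<pi> (\<lambda>e. \<chi> ((g2 \<circ> g1) ` e))"
      using g1(2) by (simp add: image_comp)
    then show "\<exists>g. pemb V E \<pi> V2 E2 \<pi>2 g \<and> (\<forall>\<tau>\<in>insert \<tau> T. H \<tau> V E \<pi> (\<lambda>e. \<chi> (g ` e)))"
      using pemb_comp[OF g1(1) g2(1)] by (intro exI[of _ "g2 \<circ> g1"] conjI)
  qed
qed

text \<open>Amalgamation over the empty set is a disjoint union, here with one copy of the graph for
  every injective placement of its vertices into \<open>N\<close> parts. Once colours depend only on
  the parts, a favourable placement can be chosen.\<close>

lemma partite_copies:
  fixes V :: "'a set"
  assumes G: "two_graph w V E"
  shows "\<exists>(V' :: nat set) E' \<pi>'. two_graph w V' E' \<and> partite E' \<pi>' \<and>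
    (\<forall>\<phi>. inj_on \<phi> V \<longrightarrow> \<phi> ` V \<subseteq> {..<N} \<longrightarrow> (\<exists>g. emb V E V' E' g \<and> (\<forall>x\<in>V. \<pi>' (g x) = \<phi> x)))"
proof -
  let ?I = "{\<phi> \<in> V \<rightarrow>\<^sub>E {..<N}. inj_on \<phi> V}"
  have fin: "finite ?I" using two_graphD(1)[OF G] by (simp add: finite_PiE)
  have part: "partite E \<phi>" if "\<phi> \<in> ?I" for \<phi>
    unfolding partite_def
  proof (intro allI ballI)
    fix d e assume "e \<in> E d"
    then have "e \<subseteq> V" using two_graphD(2)[OF G, of d] by (auto simp: nsets_def)
    then show "inj_on \<phi> e" using that by (auto intro: inj_on_subset)
  qed
  have base: "two_graph w ({} :: nat set) (\<lambda>d. {})" "partite (\<lambda>d. {} :: nat set set) id"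
    by (simp_all add: two_graph_def partite_def)
  \<comment> \<open>With \<open>D\<close> empty the gluing maps are vacuous; \<open>0\<close> is a
    dummy value.\<close>
  have f: "\<forall>\<phi>\<in>?I. inj_on (\<lambda>_. 0 :: nat) {} \<and> (\<lambda>_. 0) ` {} \<subseteq> {} \<and> partite E \<phi> \<and> (\<forall>x\<in>{}. id 0 = \<phi> x) \<and>
      (\<forall>d. \<forall>x\<in>{}. \<forall>y\<in>{}. {x, y} \<in> E d \<longleftrightarrow> {0, 0} \<in> {})"
    using part by simp
  obtain V' :: "nat set" and E' \<pi>' and \<iota> :: "nat \<Rightarrow> nat" and g where *: "two_graph w V' E'" "partite E' \<pi>'"
      "emb {} (\<lambda>d. {}) V' E' \<iota>"
      "\<forall>\<phi>\<in>?I. pemb V E \<phi> V' E' \<pi>' (g \<phi>) \<and> (\<forall>x\<in>{}. g \<phi> x = \<iota> 0)"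
    by (rule amalgamation[where f = "\<lambda>_ _. 0" and p = "\<lambda>\<phi>. \<phi>", OF G empty_subsetI base fin f])
  have "\<exists>g. emb V E V' E' g \<and> (\<forall>x\<in>V. \<pi>' (g x) = \<phi> x)" if "inj_on \<phi> V" "\<phi> ` V \<subseteq> {..<N}" for \<phi>
  proof -
    have "restrict \<phi> V \<in> ?I" using that by auto
    then have "pemb V E (restrict \<phi> V) V' E' \<pi>' (g (restrict \<phi> V))" using *(4) by blast
    then show ?thesis by (auto simp: pemb_def)
  qed
  then show ?thesis
    by (intro exI[of _ V'], intro exI[of _ E'], intro exI[of _ \<pi>'] conjI allI impI *(1,2))
qed

definition vertex_hom :: "nat \<Rightarrow> nat set \<Rightarrow> (bool \<Rightarrow> nat set set) \<Rightarrow> (nat \<Rightarrow> nat) \<Rightarrow> (nat set \<Rightarrow> 'c) \<Rightarrow> bool" where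
  "vertex_hom i V E \<pi> \<chi> \<longleftrightarrow> (\<forall>x\<in>V. \<forall>y\<in>V. \<pi> x = i \<longrightarrow> \<pi> y = i \<longrightarrow> \<chi> {x} = \<chi> {y})"

text \<open>Stars rather than all pairs between two parts: the colour may still depend on the centre
  \<open>y\<close>, a dependence that \<open>vertex_hom\<close> removes afterwards. Only
  \<open>E False\<close> occurs because the graphs treated this way have no \<open>True\<close>
  edges.\<close>

definition star_hom :: "nat \<times> nat \<Rightarrow> nat set \<Rightarrow> (bool \<Rightarrow> nat set set) \<Rightarrow> (nat \<Rightarrow> nat) \<Rightarrow> (nat set \<Rightarrow> 'c) \<Rightarrow> bool" where
  "star_hom ij V E \<pi> \<chi> \<longleftrightarrow> (\<forall>x\<in>V. \<forall>x'\<in>V. \<forall>y\<in>V. {x, y} \<in> E False \<longrightarrow> {x', y} \<in> E False \<longrightarrow>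
     \<pi> x = fst ij \<longrightarrow> \<pi> x' = fst ij \<longrightarrow> \<pi> y = snd ij \<longrightarrow> \<chi> {x, y} = \<chi> {x', y})"

lemma vertex_hom_pull:
  assumes g: "pemb V E \<pi> V' E' \<pi>' g" and h: "vertex_hom i V' E' \<pi>' \<chi>"
  shows "vertex_hom i V E \<pi> (\<lambda>e. \<chi> (g ` e))"
  unfolding vertex_hom_def
proof (intro ballI impI)
  fix x y assume xy: "x \<in> V" "y \<in> V" "\<pi> x = i" "\<pi> y = i"
  have g': "emb V E V' E' g" "\<And>x. x \<in> V \<Longrightarrow> \<pi>' (g x) = \<pi> x" using g by (auto simp: pemb_def)
  show "\<chi> (g ` {x}) = \<chi> (g ` {y})"
    using h[unfolded vertex_hom_def, rule_format, of "g x" "g y"] emb_in[OF g'(1)] g'(2) xy by simp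
qed

lemma star_hom_pull:
  assumes g: "pemb V E \<pi> V' E' \<pi>' g" and h: "star_hom ij V' E' \<pi>' \<chi>"
  shows "star_hom ij V E \<pi> (\<lambda>e. \<chi> (g ` e))"
  unfolding star_hom_def
proof (intro ballI impI)
  fix x x' y assume x: "x \<in> V" "x' \<in> V" "y \<in> V" and e: "{x, y} \<in> E False" "{x', y} \<in> E False"
    and p: "\<pi> x = fst ij" "\<pi> x' = fst ij" "\<pi> y = snd ij"
  have g': "emb V E V' E' g" "\<And>x. x \<in> V \<Longrightarrow> \<pi>' (g x) = \<pi> x" using g by (auto simp: pemb_def)
  have "\<chi> {g x, g y} = \<chi> {g x', g y}"
    using h[unfolded star_hom_def, rule_format, of "g x" "g x'" "g y"]
      emb_edge[OF g'(1) e(1)] emb_edge[OF g'(1) e(2)] emb_in[OF g'(1)] g'(2) x p by simp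
  then show "\<chi> (g ` {x, y}) = \<chi> (g ` {x', y})" by simp
qed

text \<open>Part \<open>i\<close> is an independent set \<open>D\<close>. It is enlarged to
  \<open>card D * card K\<close> independent points, and a copy of the graph is glued along every
  injection of \<open>D\<close> into them. Some \<open>card D\<close> of these points share a
  colour, and the copy through them is homogeneous in part \<open>i\<close>.\<close>

lemma vertex_step:
  fixes V :: "nat set" and K :: "'c set"
  assumes G: "two_graph w V E" and \<pi>: "partite E \<pi>" and w: "\<And>d. 1 \<le> w d" and K: "finite K" "K \<noteq> {}"
  shows "realizable w K V E \<pi> (vertex_hom i V E \<pi>)"
proof -
  define D where "D = {x \<in> V. \<pi> x = i}"
  have fD: "finite D" using two_graphD(1)[OF G] by (simp add: D_def)
  define M where "M = card D * card K"
  let ?I = "{f \<in> D \<rightarrow>\<^sub>E {..<M}. inj_on f D}"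
  have fin: "finite ?I" using fD by (simp add: finite_PiE)
  have base: "two_graph w {..<M} (\<lambda>d. {})"
    unfolding two_graph_def
  proof (intro conjI allI impI)
    fix d and C :: "nat set" assume C: "C \<subseteq> {..<M}" "clique C {}"
    then have "card C \<le> 1"
      using card_le_Suc0_iff_eq[OF finite_subset[OF C(1) finite_lessThan]] by (auto simp: clique_def)
    then show "card C \<le> w d" using w[of d] by linarith
  qed auto
  have none: "{x, y} \<notin> E d" if "x \<in> D" "y \<in> D" for x y d
    using partite_edge[OF \<pi>, of x y d] two_graph_edgeD[OF G, of x y d] that by (auto simp: D_def)
  have D: "D \<subseteq> V" by (auto simp: D_def)
  have part: "partite (\<lambda>d. {} :: nat set set) (\<lambda>_. i)" by (simp add: partite_def)
  have f: "\<forall>f\<in>?I. inj_on f D \<and> f ` D \<subseteq> {..<M} \<and> partite E \<pi> \<and> (\<forall>x\<in>D. i = \<pi> x) \<and>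
      (\<forall>d. \<forall>x\<in>D. \<forall>y\<in>D. {x, y} \<in> E d \<longleftrightarrow> {f x, f y} \<in> {})"
    using none \<pi> by (auto simp: D_def)
  obtain V' :: "nat set" and E' \<pi>' \<iota> g where *: "two_graph w V' E'" "partite E' \<pi>'"
      "emb {..<M} (\<lambda>d. {}) V' E' \<iota>"
      "\<forall>f\<in>?I. pemb V E \<pi> V' E' \<pi>' (g f) \<and> (\<forall>x\<in>D. g f x = \<iota> (f x))"
    by (rule amalgamation[where f = "\<lambda>f. f" and p = "\<lambda>_. \<pi>", OF G D base part fin f])
  show ?thesis
  proof (rule realizableI[OF *(1,2)])
    fix \<chi> :: "nat set \<Rightarrow> 'c" assume \<chi>: "\<And>e. \<chi> e \<in> K"
    have "(\<lambda>y. \<chi> {\<iota> y}) \<in> {..<M} \<rightarrow> K" using \<chi> by simp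
    from pigeonhole_card[OF this finite_lessThan K]
    obtain c where c: "M \<le> card ((\<lambda>y. \<chi> {\<iota> y}) -` {c} \<inter> {..<M}) * card K" by auto
    have "0 < card K" using K by (simp add: card_gt_0_iff)
    then have "card D \<le> card ((\<lambda>y. \<chi> {\<iota> y}) -` {c} \<inter> {..<M})" using c by (simp add: M_def)
    then obtain f where f: "f ` D \<subseteq> (\<lambda>y. \<chi> {\<iota> y}) -` {c} \<inter> {..<M}" "inj_on f D"
      using card_le_inj[OF fD, of "(\<lambda>y. \<chi> {\<iota> y}) -` {c} \<inter> {..<M}"] by auto
    let ?f = "restrict f D"
    have "?f \<in> ?I" using f by auto
    then have g: "pemb V E \<pi> V' E' \<pi>' (g ?f) \<and> (\<forall>x\<in>D. g ?f x = \<iota> (?f x))" using *(4) by blast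
    have "\<chi> {g ?f x} = c" if "x \<in> D" for x using f(1) g that by auto
    then have "vertex_hom i V E \<pi> (\<lambda>e. \<chi> (g ?f ` e))" by (simp add: vertex_hom_def D_def)
    then show "\<exists>g. pemb V E \<pi> V' E' \<pi>' g \<and> vertex_hom i V E \<pi> (\<lambda>e. \<chi> (g ` e))"
      using g by (intro exI[of _ "g ?f"] conjI) simp_all
  qed
qed

text \<open>The colour of a \<open>q\<close>-set will itself be a function, so the palette is an
  arbitrary finite set, numbered by \<open>b\<close>.\<close>

lemma Ramsey_finite_colours:
  fixes K :: "'c set"
  assumes K: "finite K" "K \<noteq> {}"
  shows "\<exists>M::nat. \<forall>F. (\<forall>Y. F Y \<in> K) \<longrightarrow> (\<exists>W c. W \<subseteq> {..<M} \<and> card W = L \<and> (\<forall>Y\<in>nsets W q. F Y = c))"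
proof -
  obtain M :: nat where M: "partn_lst {..<M} (replicate (card K) L) q" using ramsey_full by blast
  obtain b where b: "bij_betw b K {..<card K}"
    using ex_bij_betw_finite_nat[OF K(1)] by (metis atLeast0LessThan)
  have "\<exists>W c. W \<subseteq> {..<M} \<and> card W = L \<and> (\<forall>Y\<in>nsets W q. F Y = c)" if F: "\<forall>Y. F Y \<in> K" for F
  proof -
    have "(\<lambda>Y. b (F Y)) \<in> nsets {..<M} q \<rightarrow> {..<card K}"
      using F bij_betwE[OF b] by blast
    then obtain i W where W: "i < card K" "W \<in> nsets {..<M} (replicate (card K) L ! i)"
        "(\<lambda>Y. b (F Y)) ` nsets W q \<subseteq> {i}"
      using partn_lstE[OF M] by (metis length_replicate)
    have "F Y = inv_into K b i" if "Y \<in> nsets W q" for Y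
      using W(3) that F b by (auto simp: bij_betw_def)
    then show ?thesis using W(1,2) by (auto simp: nsets_def)
  qed
  then show ?thesis by blast
qed

subsection \<open>Monochromatic stars\<close>

text \<open>Call the points \<open>2 * q * (i + 1)\<close> anchors. The \<open>q\<close> positions
  are to be mapped increasingly so that exactly the anchors with \<open>i\<close> in
  \<open>N\<close> are hit, and only from positions in \<open>J\<close>. Position \<open>l\<close>
  is sent into block number \<open>cnt l\<close> of length \<open>2 * q\<close>, so that each
  element of \<open>J\<close> opens a new block; it takes the anchor at the start of the block or
  skips it.\<close>

lemma spread_positions:
  fixes J N :: "nat set"
  assumes J: "J \<subseteq> {..<q}" "card J = n" and N: "N \<subseteq> {..<n}"
  obtains y :: "nat \<Rightarrow> nat" where "\<And>l l'. l < l' \<Longrightarrow> l' < q \<Longrightarrow> y l < y l'"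
    "\<And>l. l < q \<Longrightarrow> y l < 2 * q * (n + 1)"
    "\<And>l i. l < q \<Longrightarrow> y l = 2 * q * (i + 1) \<Longrightarrow> l \<in> J \<and> i \<in> N"
    "\<And>i. i \<in> N \<Longrightarrow> \<exists>l\<in>J. y l = 2 * q * (i + 1)"
proof -
  have fJ: "finite J" using J(1) finite_subset by blast
  define cnt where "cnt l = card (J \<inter> {..l})" for l
  \<comment> \<open>The element of \<open>J\<close> with \<open>cnt l = i + 1\<close> is responsible
    for anchor \<open>i\<close>, hence the subtraction. Elsewhere, for \<open>l < q\<close>, the
    offset \<open>1 + l\<close> grows with \<open>l\<close> and stays strictly between 0 and
    \<open>2 * q\<close>, so no other anchor is hit.\<close>
  define off where "off l = (if l \<in> J \<and> cnt l - 1 \<in> N then 0 else 1 + l)" for l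
  define y where "y l = 2 * q * cnt l + off l" for l
  have off: "off l \<le> q" if "l < q" for l using that by (simp add: off_def)
  have mono: "cnt l \<le> cnt l'" if "l \<le> l'" for l l'
    unfolding cnt_def using that fJ by (intro card_mono) auto
  have mono_J: "cnt l < cnt l'" if "l < l'" "l' \<in> J" for l l'
  proof -
    have "J \<inter> {..l} \<subseteq> J \<inter> {..l'}" "l' \<in> J \<inter> {..l'}" "l' \<notin> J \<inter> {..l}" using that by auto
    then have "J \<inter> {..l} \<subset> J \<inter> {..l'}" by blast
    then show ?thesis unfolding cnt_def using fJ by (intro psubset_card_mono) auto
  qed
  have cnt_le: "cnt l \<le> n" for l
    unfolding cnt_def J(2)[symmetric] using fJ by (intro card_mono) auto
  have pos: "1 \<le> cnt l" if "l \<in> J" for l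
  proof -
    have "card {l} \<le> cnt l" unfolding cnt_def using that fJ by (intro card_mono) auto
    then show ?thesis by simp
  qed
  have inj: "inj_on cnt J"
    by (rule inj_onI) (metis less_irrefl linorder_neqE_nat mono_J)
  have "cnt ` J = {1..n}"
    using pos cnt_le card_image[OF inj] J(2) by (intro card_subset_eq) auto
  show ?thesis
  proof
    fix l l' :: nat assume l: "l < l'" "l' < q"
    show "y l < y l'"
    proof (cases "cnt l = cnt l'")
      case True
      then have "l' \<notin> J" using mono_J[OF l(1)] by force
      then show ?thesis using True l by (simp add: y_def off_def)
    next
      case False
      then have "cnt l + 1 \<le> cnt l'" using mono[of l l'] l(1) by simp
      then have "2 * q * (cnt l + 1) \<le> 2 * q * cnt l'" by (intro mult_le_mono) auto
      moreover have "off l \<le> q" using off l by simp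
      ultimately show ?thesis using l unfolding y_def distrib_left mult_1_right by linarith
    qed
  next
    fix l assume l: "l < q"
    have "2 * q * cnt l \<le> 2 * q * n" using cnt_le by (intro mult_le_mono) auto
    then show "y l < 2 * q * (n + 1)"
      using off[OF l] l unfolding y_def distrib_left mult_1_right by linarith
  next
    fix l i assume l: "l < q" and eq: "y l = 2 * q * (i + 1)"
    have "off l = y l mod (2 * q)" using off[OF l] l by (simp add: y_def)
    then have "off l = 0" by (simp add: eq)
    then have "l \<in> J" "cnt l - 1 \<in> N" by (auto simp: off_def split: if_splits)
    moreover have "2 * q * cnt l = 2 * q * (i + 1)"
      using eq unfolding y_def \<open>off l = 0\<close> by (simp only: add_0_right)
    then have "cnt l = i + 1" using l by (simp only: mult_cancel1) simp
    ultimately show "l \<in> J \<and> i \<in> N" by simp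
  next
    fix i assume i: "i \<in> N"
    then have "i + 1 \<in> cnt ` J" using N \<open>cnt ` J = {1..n}\<close> by auto
    then obtain l where "l \<in> J" "cnt l = i + 1" by auto
    then show "\<exists>l\<in>J. y l = 2 * q * (i + 1)" using i by (intro bexI[of _ l]) (simp_all add: y_def off_def)
  qed
qed

text \<open>A bipartite graph is embedded into the incidence graph of \<open>{..<M}\<close> and its \<open>q\<close>-subsets:
  by Ramsey's theorem the colours at \<open>Y\<close> may be assumed to depend only on the positions in \<open>Y\<close>,
  and half of the \<open>q = 2n\<close> positions have the same colour.\<close>
lemma star_embedding:
  fixes A :: "'a set" and B :: "'b set" and rel :: "'a \<Rightarrow> 'b \<Rightarrow> bool"
  assumes A: "finite A" and B: "finite B"
  shows "\<exists>(M :: nat) q. \<forall>\<chi> :: nat \<Rightarrow> 'b \<Rightarrow> nat set \<Rightarrow> bool. \<exists>\<alpha> Y. inj_on \<alpha> A \<and> \<alpha> ` A \<subseteq> {..<M} \<and>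
    (\<forall>b\<in>B. Y b \<in> nsets {..<M} q \<and> (\<forall>a\<in>A. \<alpha> a \<in> Y b \<longleftrightarrow> rel a b) \<and>
      (\<exists>c. \<forall>a\<in>A. rel a b \<longrightarrow> \<chi> (\<alpha> a) b (Y b) = c))"
proof -
  define n where "n = card A"
  define q where "q = 2 * n"
  obtain e where e: "bij_betw e A {..<n}"
    using ex_bij_betw_finite_nat[OF A] by (auto simp: n_def atLeast0LessThan)
  let ?K = "(B \<times> {..<q}) \<rightarrow>\<^sub>E (UNIV :: bool set)"
  have K: "finite ?K" "?K \<noteq> {}" using B by (simp_all add: finite_PiE PiE_eq_empty_iff)
  obtain M :: nat where M: "\<forall>F. (\<forall>Y. F Y \<in> ?K) \<longrightarrow>
      (\<exists>W c. W \<subseteq> {..<M} \<and> card W = 2 * q * (n + 1) \<and> (\<forall>Y\<in>nsets W q. F Y = c))"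
    using Ramsey_finite_colours[OF K, of "2 * q * (n + 1)" q] by (elim exE)
  have "\<exists>\<alpha> Y. inj_on \<alpha> A \<and> \<alpha> ` A \<subseteq> {..<M} \<and>
    (\<forall>b\<in>B. Y b \<in> nsets {..<M} q \<and> (\<forall>a\<in>A. \<alpha> a \<in> Y b \<longleftrightarrow> rel a b) \<and>
      (\<exists>c. \<forall>a\<in>A. rel a b \<longrightarrow> \<chi> (\<alpha> a) b (Y b) = c))" for \<chi> :: "nat \<Rightarrow> 'b \<Rightarrow> nat set \<Rightarrow> bool"
  proof -
    \<comment> \<open>\<open>F Y\<close> records, for every \<open>b\<close> and every position
      \<open>l\<close>, the colour of the pair of the \<open>l\<close>-th element of
      \<open>Y\<close> and \<open>(b, Y)\<close>. It is constant on the \<open>q\<close>-subsets of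
      \<open>W\<close>, so there only \<open>b\<close> and the position matter.\<close>
    define F where "F Y = restrict (\<lambda>(b, l). \<chi> (sorted_list_of_set Y ! l) b Y) (B \<times> {..<q})" for Y
    have "\<forall>Y. F Y \<in> ?K" by (simp add: F_def)
    from M[THEN spec, THEN mp, OF this]
    obtain W P where W: "W \<subseteq> {..<M}" "card W = 2 * q * (n + 1)" and P: "\<forall>Y\<in>nsets W q. F Y = P"
      by (elim exE conjE)
    have fW: "finite W" using W(1) finite_subset by blast
    define w where "w l = sorted_list_of_set W ! l" for l
    have w_mono: "w l < w l'" if "l < l'" "l' < 2 * q * (n + 1)" for l l'
      unfolding w_def using that W(2)
      by (intro sorted_wrt_nth_less[OF strict_sorted_list_of_set]) (simp_all add: fW)
    have w_in: "w l \<in> W" if "l < 2 * q * (n + 1)" for l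
      using nth_mem[of l "sorted_list_of_set W"] that W(2) fW by (simp add: w_def)
    have w_eq: "w l = w l' \<longleftrightarrow> l = l'" if "l < 2 * q * (n + 1)" "l' < 2 * q * (n + 1)" for l l'
      using w_mono that by (metis less_irrefl linorder_neqE_nat)
    have e_lt: "e a < n" if "a \<in> A" for a using e that by (auto simp: bij_betw_def)
    have e_idx: "2 * q * (e a + 1) < 2 * q * (n + 1)" if "a \<in> A" for a
      using e_lt[OF that] by (simp add: q_def)
    \<comment> \<open>\<open>A\<close> goes to equally spaced anchors of \<open>W\<close>; the gaps
      supply the elements that fill the sets \<open>Y\<close> up to size \<open>q\<close>.\<close>
    define \<alpha> where "\<alpha> a = w (2 * q * (e a + 1))" for a
    have inj_\<alpha>: "inj_on \<alpha> A"
    proof (rule inj_onI)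
      fix a a' assume a: "a \<in> A" "a' \<in> A" "\<alpha> a = \<alpha> a'"
      then have "2 * q * (e a + 1) = 2 * q * (e a' + 1)" using w_eq[OF e_idx e_idx] by (simp add: \<alpha>_def)
      then have "e a = e a'" using e_lt[OF a(1)] by (simp add: q_def)
      then show "a = a'" using e a by (auto simp: bij_betw_def inj_on_def)
    qed
    have sub_\<alpha>: "\<alpha> ` A \<subseteq> {..<M}" using w_in[OF e_idx] W(1) by (auto simp: \<alpha>_def)
    have "\<exists>Y. Y \<in> nsets {..<M} q \<and> (\<forall>a\<in>A. \<alpha> a \<in> Y \<longleftrightarrow> rel a b) \<and>
      (\<exists>c. \<forall>a\<in>A. rel a b \<longrightarrow> \<chi> (\<alpha> a) b Y = c)" if b: "b \<in> B" for b
    proof -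
      \<comment> \<open>Two colours on \<open>2 * n\<close> positions: one of them occurs at least
        \<open>n\<close> times, enough for all of \<open>A\<close>.\<close>
      have "\<exists>c. n \<le> card {l \<in> {..<q}. P (b, l) = c}"
      proof (rule ccontr)
        assume "\<nexists>c. n \<le> card {l \<in> {..<q}. P (b, l) = c}"
        then have lt: "card {l \<in> {..<q}. P (b, l) = c} < n" for c by (simp add: not_le)
        have "card {l \<in> {..<q}. P (b, l) = True} < n" "card {l \<in> {..<q}. P (b, l) = False} < n"
          by (rule lt)+
        moreover have "{..<q} = {l \<in> {..<q}. P (b, l) = True} \<union> {l \<in> {..<q}. P (b, l) = False}" by auto
        then have "q \<le> card {l \<in> {..<q}. P (b, l) = True} + card {l \<in> {..<q}. P (b, l) = False}"
          by (metis card_Un_le card_lessThan)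
        ultimately show False by (simp add: q_def)
      qed
      then obtain c J where J: "J \<subseteq> {l \<in> {..<q}. P (b, l) = c}" "card J = n"
        by (meson obtain_subset_with_card_n)
      \<comment> \<open>\<open>N\<close> marks the anchors of the neighbours of \<open>b\<close>. A
        set \<open>Y\<close> containing exactly these anchors, all at positions in \<open>J\<close>,
        has the incidences prescribed by \<open>rel\<close> and gives them all the colour
        \<open>c\<close>.\<close>
      define N where "N = e ` {a \<in> A. rel a b}"
      have "J \<subseteq> {..<q}" "N \<subseteq> {..<n}" using J e_lt by (auto simp: N_def)
      from spread_positions[OF this(1) J(2) this(2)]
      obtain y where y_mono: "\<And>l l'. l < l' \<Longrightarrow> l' < q \<Longrightarrow> y l < y l'"
        and y_lt: "\<And>l. l < q \<Longrightarrow> y l < 2 * q * (n + 1)"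
        and y_N: "\<And>l i. l < q \<Longrightarrow> y l = 2 * q * (i + 1) \<Longrightarrow> l \<in> J \<and> i \<in> N"
        and y_ex: "\<And>i. i \<in> N \<Longrightarrow> \<exists>l\<in>J. y l = 2 * q * (i + 1)" by metis
      define ys where "ys = map (\<lambda>l. w (y l)) [0..<q]"
      define Y where "Y = set ys"
      have len: "length ys = q" by (simp add: ys_def)
      have sorted: "sorted_wrt (<) ys"
        unfolding sorted_wrt_iff_nth_less by (auto simp: ys_def intro!: w_mono y_mono y_lt)
      have ys: "sorted_list_of_set Y = ys"
        unfolding Y_def using sorted by (intro sorted_list_of_set.idem_if_sorted_distinct) (auto simp: strict_sorted_iff)
      have "card Y = q"
        unfolding Y_def using sorted by (simp add: strict_sorted_iff distinct_card len)
      moreover have "Y \<subseteq> W" using w_in y_lt by (auto simp: Y_def ys_def)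
      moreover have "finite Y" by (simp add: Y_def)
      ultimately have YW: "Y \<in> nsets W q" by (simp add: nsets_def)
      have in_Y: "\<alpha> a \<in> Y \<longleftrightarrow> (\<exists>l<q. y l = 2 * q * (e a + 1))" if "a \<in> A" for a
      proof -
        have "Y = (\<lambda>l. w (y l)) ` {..<q}" by (simp add: Y_def ys_def atLeast0LessThan)
        then have "\<alpha> a \<in> Y \<longleftrightarrow> (\<exists>l<q. w (2 * q * (e a + 1)) = w (y l))" unfolding \<alpha>_def by blast
        then show ?thesis using w_eq[OF e_idx[OF that] y_lt] by metis
      qed
      have e_N: "e a \<in> N \<longleftrightarrow> rel a b" if "a \<in> A" for a
        using e that by (auto simp: N_def bij_betw_def inj_on_def)
      have rel: "\<alpha> a \<in> Y \<longleftrightarrow> rel a b" if "a \<in> A" for a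
        using in_Y[OF that] e_N[OF that] y_N y_ex[of "e a"] \<open>J \<subseteq> {..<q}\<close> by blast
      have col: "\<chi> (\<alpha> a) b Y = c" if a: "a \<in> A" "rel a b" for a
      proof -
        obtain l where l: "l \<in> J" "y l = 2 * q * (e a + 1)" using y_ex e_N a by blast
        have "l < q" using l J by auto
        have "\<chi> (\<alpha> a) b Y = F Y (b, l)"
          using \<open>l < q\<close> b l(2) by (simp add: F_def ys) (simp add: ys_def \<alpha>_def)
        also have "\<dots> = c" using bspec[OF P YW] J l(1) by auto
        finally show ?thesis .
      qed
      have "Y \<in> nsets {..<M} q" using nsets_mono[OF W(1)] YW by blast
      then show ?thesis using rel col by (intro exI[of _ Y] conjI exI[of _ c]) simp_all
    qed
    then have "\<forall>b\<in>B. \<exists>Y. Y \<in> nsets {..<M} q \<and> (\<forall>a\<in>A. \<alpha> a \<in> Y \<longleftrightarrow> rel a b) \<and>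
      (\<exists>c. \<forall>a\<in>A. rel a b \<longrightarrow> \<chi> (\<alpha> a) b Y = c)" by simp
    from bchoice[OF this] inj_\<alpha> sub_\<alpha> show ?thesis by (elim exE) (intro exI conjI)
  qed
  then show ?thesis by (rule exI[of _ M, OF exI[of _ q, OF allI]])
qed

text \<open>The bipartite graph between parts \<open>i\<close> and \<open>j\<close> is embedded as
  an induced subgraph into the incidence graph of \<open>star_embedding\<close>, and a copy of the
  whole graph is glued along every such embedding. The incidence graph is bipartite, so
  \<open>2 \<le> w False\<close> leaves room for its cliques.\<close>

lemma star_step:
  fixes V :: "nat set"
  assumes G: "two_graph w V E" and \<pi>: "partite E \<pi>" and w: "w True = 1" "2 \<le> w False" and ij: "i \<noteq> j"
  shows "realizable w (UNIV :: bool set) V E \<pi> (star_hom (i, j) V E \<pi>)"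
proof -
  define A where "A = {x \<in> V. \<pi> x = i}"
  define B where "B = {x \<in> V. \<pi> x = j}"
  define D where "D = A \<union> B"
  have fin: "finite A" "finite B" using two_graphD(1)[OF G] by (simp_all add: A_def B_def)
  have D: "D \<subseteq> V" by (auto simp: A_def B_def D_def)
  have disj: "A \<inter> B = {}" using ij by (auto simp: A_def B_def)
  \<comment> \<open>A \<open>True\<close> edge would be a clique of size 2, against
    \<open>w True = 1\<close>.\<close>
  have ET: "{x, y} \<notin> E True" for x y
  proof
    assume e: "{x, y} \<in> E True"
    then have "clique {x, y} (E True)" by (auto simp: clique_def insert_commute)
    then have "card {x, y} \<le> 1"
      using two_graphD(3)[OF G, of "{x, y}" True] two_graph_edgeD[OF G e] w by simp
    then show False using two_graph_edgeD(3)[OF G e] by simp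
  qed
  obtain M :: nat and q where M: "\<forall>\<chi> :: nat \<Rightarrow> nat \<Rightarrow> nat set \<Rightarrow> bool. \<exists>\<alpha> Y. inj_on \<alpha> A \<and> \<alpha> ` A \<subseteq> {..<M} \<and>
    (\<forall>b\<in>B. Y b \<in> nsets {..<M} q \<and> (\<forall>a\<in>A. \<alpha> a \<in> Y b \<longleftrightarrow> {a, b} \<in> E False) \<and>
      (\<exists>c. \<forall>a\<in>A. {a, b} \<in> E False \<longrightarrow> \<chi> (\<alpha> a) b (Y b) = c))"
    using star_embedding[OF fin, of "\<lambda>a b. {a, b} \<in> E False"] by (elim exE)
  \<comment> \<open>Each \<open>b\<close> has its own family of \<open>q\<close>-subsets, so
    vertices of \<open>B\<close> with equal neighbourhoods still get different images.\<close>
  define D' :: "(nat + nat \<times> nat set) set" where "D' = Inl ` {..<M} \<union> Inr ` (B \<times> nsets {..<M} q)"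
  define E0 where "E0 d = (if d then {} else
      {{Inl x, Inr (b, Y)} |x b Y. x < M \<and> b \<in> B \<and> Y \<in> nsets {..<M} q \<and> x \<in> Y})" for d
  define \<pi>0 :: "nat + nat \<times> nat set \<Rightarrow> nat" where "\<pi>0 z = (case z of Inl _ \<Rightarrow> i | Inr _ \<Rightarrow> j)" for z
  have part: "partite E0 \<pi>0"
    using ij by (auto simp: partite_def E0_def \<pi>0_def)
  have base: "two_graph w D' E0"
    unfolding two_graph_def
  proof (intro conjI allI impI)
    show fD': "finite D'" using fin by (simp add: D'_def finite_imp_finite_nsets)
    show "E0 d \<subseteq> nsets D' 2" for d by (auto simp: E0_def D'_def)
    fix d C assume C: "C \<subseteq> D'" "clique C (E0 d)"
    have fC: "finite C" using C(1) fD' finite_subset by blast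
    show "card C \<le> w d"
    proof (cases d)
      case True
      then have "card C \<le> 1" using C(2) card_le_Suc0_iff_eq[OF fC] by (auto simp: clique_def E0_def)
      then show ?thesis using True w by simp
    next
      case False
      have "card C = card (\<pi>0 ` C)" using partite_clique[OF part C(2)] by (simp add: card_image)
      also have "\<dots> \<le> card {i, j}" by (intro card_mono) (auto simp: \<pi>0_def split: sum.split)
      also have "\<dots> \<le> 2" by (simp add: card_insert_if)
      finally show ?thesis using False w by simp
    qed
  qed
  have E0F: "{Inl x, Inr (b, Y)} \<in> E0 False \<longleftrightarrow> x < M \<and> b \<in> B \<and> Y \<in> nsets {..<M} q \<and> x \<in> Y" for x b Y
    by (auto simp: E0_def doubleton_eq_iff)
  let ?I = "{f \<in> D \<rightarrow>\<^sub>E D'. inj_on f D \<and> (\<forall>x\<in>D. \<pi>0 (f x) = \<pi> x) \<and>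
      (\<forall>x\<in>D. \<forall>y\<in>D. {x, y} \<in> E False \<longleftrightarrow> {f x, f y} \<in> E0 False)}"
  have fI: "finite ?I" using fin two_graphD(1)[OF base] by (simp add: D_def finite_PiE)
  have f: "\<forall>f\<in>?I. inj_on f D \<and> f ` D \<subseteq> D' \<and> partite E \<pi> \<and> (\<forall>x\<in>D. \<pi>0 (f x) = \<pi> x) \<and>
      (\<forall>d. \<forall>x\<in>D. \<forall>y\<in>D. {x, y} \<in> E d \<longleftrightarrow> {f x, f y} \<in> E0 d)"
  proof (intro ballI conjI allI \<pi>)
    fix f d x y assume f: "f \<in> ?I" "x \<in> D" "y \<in> D"
    show "{x, y} \<in> E d \<longleftrightarrow> {f x, f y} \<in> E0 d"
      using f ET by (cases d) (simp_all add: E0_def[of True])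
  qed auto
  obtain V' :: "nat set" and E' \<pi>' \<iota> g where *: "two_graph w V' E'" "partite E' \<pi>'"
      "emb D' E0 V' E' \<iota>"
      "\<forall>f\<in>?I. pemb V E \<pi> V' E' \<pi>' (g f) \<and> (\<forall>x\<in>D. g f x = \<iota> (f x))"
    by (rule amalgamation[where f = "\<lambda>f. f" and p = "\<lambda>_. \<pi>", OF G D base part fI f])
  show ?thesis
  proof (rule realizableI[OF *(1,2)])
    fix \<chi> :: "nat set \<Rightarrow> bool"
    obtain \<alpha> Y where \<alpha>: "inj_on \<alpha> A" "\<alpha> ` A \<subseteq> {..<M}"
      and Y: "\<forall>b\<in>B. Y b \<in> nsets {..<M} q \<and> (\<forall>a\<in>A. \<alpha> a \<in> Y b \<longleftrightarrow> {a, b} \<in> E False) \<and>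
      (\<exists>c. \<forall>a\<in>A. {a, b} \<in> E False \<longrightarrow> \<chi> {\<iota> (Inl (\<alpha> a)), \<iota> (Inr (b, Y b))} = c)"
      using M[THEN spec, of "\<lambda>x b Y. \<chi> {\<iota> (Inl x), \<iota> (Inr (b, Y))}"] by (elim exE conjE)
    define f where "f = restrict (\<lambda>x. if x \<in> A then Inl (\<alpha> x) else Inr (x, Y x)) D"
    have fA: "f x = Inl (\<alpha> x)" if "x \<in> A" for x using that by (simp add: f_def D_def)
    have fB: "f x = Inr (x, Y x)" if "x \<in> B" for x using that disj by (auto simp: f_def D_def)
    have "f x \<in> D'" if "x \<in> D" for x
      using that \<alpha>(2) Y unfolding D_def by (auto simp: fA fB D'_def)
    then have "f \<in> D \<rightarrow>\<^sub>E D'" by (simp add: f_def)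
    moreover have "inj_on f D"
    proof (rule inj_onI)
      fix x y assume xy: "x \<in> D" "y \<in> D" "f x = f y"
      have "x \<in> A \<or> x \<in> B" "y \<in> A \<or> y \<in> B" using xy(1,2) by (auto simp: D_def)
      then show "x = y"
        using xy(3) by (elim disjE) (simp_all add: fA fB inj_on_eq_iff[OF \<alpha>(1)])
    qed
    moreover have "\<pi>0 (f x) = \<pi> x" if "x \<in> D" for x
      using that unfolding D_def by (auto simp: fA fB \<pi>0_def) (auto simp: A_def B_def)
    moreover have "{x, y} \<in> E False \<longleftrightarrow> {f x, f y} \<in> E0 False" if xy: "x \<in> D" "y \<in> D" for x y
    proof -
      have same: "\<not> ({x, y} \<in> E False) \<and> \<not> ({f x, f y} \<in> E0 False)" if "\<pi> x = \<pi> y"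
      proof
        show "{x, y} \<notin> E False"
          using partite_edge[OF \<pi>, of x y False] two_graph_edgeD[OF G, of x y False] that by blast
        show "{f x, f y} \<notin> E0 False"
          using partite_edge[OF part, of "f x" "f y" False] two_graph_edgeD[OF base, of "f x" "f y" False]
            calculation(3)[OF xy(1)] calculation(3)[OF xy(2)] that by metis
      qed
      have AB: "{x, y} \<in> E False \<longleftrightarrow> {f x, f y} \<in> E0 False" if "x \<in> A" "y \<in> B" for x y
        using that Y \<alpha>(2) by (auto simp: fA fB E0F)
      consider "\<pi> x = \<pi> y" | "x \<in> A" "y \<in> B" | "y \<in> A" "x \<in> B"
        using xy by (auto simp: A_def B_def D_def)
      then show ?thesis
      proof cases
        case 1
        then show ?thesis using same by blast
      next
        case 2
        then show ?thesis by (rule AB)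
      next
        case 3
        then show ?thesis using AB[OF 3] by (simp add: insert_commute)
      qed
    qed
    ultimately have "f \<in> ?I" by blast
    then have g: "pemb V E \<pi> V' E' \<pi>' (g f)" and g\<iota>: "\<And>x. x \<in> D \<Longrightarrow> g f x = \<iota> (f x)"
      using *(4) by auto
    have "star_hom (i, j) V E \<pi> (\<lambda>e. \<chi> (g f ` e))"
      unfolding star_hom_def
    proof (intro ballI impI, simp only: fst_conv snd_conv)
      fix x x' y assume x: "x \<in> V" "x' \<in> V" "y \<in> V" "\<pi> x = i" "\<pi> x' = i" "\<pi> y = j"
        and e: "{x, y} \<in> E False" "{x', y} \<in> E False"
      have AB: "x \<in> A" "x' \<in> A" "y \<in> B" using x by (auto simp: A_def B_def)
      then have "g f x = \<iota> (Inl (\<alpha> x))" "g f x' = \<iota> (Inl (\<alpha> x'))" "g f y = \<iota> (Inr (y, Y y))"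
        using g\<iota> by (simp_all add: D_def fA fB)
      then show "\<chi> (g f ` {x, y}) = \<chi> (g f ` {x', y})"
        using bspec[OF Y AB(3)] e AB by auto
    qed
    then show "\<exists>g. pemb V E \<pi> V' E' \<pi>' g \<and> star_hom (i, j) V E \<pi> (\<lambda>e. \<chi> (g ` e))"
      using g by (intro exI[of _ "g f"] conjI)
  qed
qed

section \<open>Monochromatic cliques of an arbitrary colouring\<close>

text \<open>The union over both colours forgets the exhibited colouring: only adjacency and
  \<open>\<chi>\<close> count. Finiteness is demanded because infinite sets have \<open>card\<close>
  0.\<close>

definition has_mono :: "'a set \<Rightarrow> (bool \<Rightarrow> 'a set set) \<Rightarrow> ('a set \<Rightarrow> bool) \<Rightarrow> bool \<Rightarrow> nat \<Rightarrow> bool" where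
  "has_mono A E \<chi> \<kappa> n \<longleftrightarrow> (\<exists>C\<subseteq>A. card C = n \<and> finite C \<and> clique C {e \<in> \<Union>(range E). \<chi> e = \<kappa>})"

lemma has_monoI:
  assumes "C \<subseteq> A" "card C = n" "finite C"
    and "\<And>x y. x \<in> C \<Longrightarrow> y \<in> C \<Longrightarrow> x \<noteq> y \<Longrightarrow> \<exists>d. {x, y} \<in> E d"
    and "\<And>x y. x \<in> C \<Longrightarrow> y \<in> C \<Longrightarrow> x \<noteq> y \<Longrightarrow> \<chi> {x, y} = \<kappa>"
  shows "has_mono A E \<chi> \<kappa> n"
  unfolding has_mono_def using assms by (intro exI[of _ C] conjI cliqueI) auto

lemma has_monoE:
  assumes "has_mono A E \<chi> \<kappa> n"
  obtains C where "C \<subseteq> A" "card C = n" "finite C"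
    "\<And>x y. x \<in> C \<Longrightarrow> y \<in> C \<Longrightarrow> x \<noteq> y \<Longrightarrow> \<exists>d. {x, y} \<in> E d"
    "\<And>x y. x \<in> C \<Longrightarrow> y \<in> C \<Longrightarrow> x \<noteq> y \<Longrightarrow> \<chi> {x, y} = \<kappa>"
proof -
  obtain C where C: "C \<subseteq> A" "card C = n" "finite C" "clique C {e \<in> \<Union>(range E). \<chi> e = \<kappa>}"
    using assms unfolding has_mono_def by blast
  show thesis
    by (rule that[OF C(1-3)]) (use cliqueD[OF C(4)] in auto)
qed

lemma has_mono_le:
  assumes "has_mono A E \<chi> \<kappa> n" "m \<le> n"
  shows "has_mono A E \<chi> \<kappa> m"
  using assms(1)
proof (rule has_monoE)
  fix C assume C: "C \<subseteq> A" "card C = n" "finite C"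
    "\<And>x y. x \<in> C \<Longrightarrow> y \<in> C \<Longrightarrow> x \<noteq> y \<Longrightarrow> \<exists>d. {x, y} \<in> E d"
    "\<And>x y. x \<in> C \<Longrightarrow> y \<in> C \<Longrightarrow> x \<noteq> y \<Longrightarrow> \<chi> {x, y} = \<kappa>"
  obtain C' where C': "C' \<subseteq> C" "card C' = m" "finite C'"
    using obtain_subset_with_card_n[of m C] assms(2) C(2) by blast
  show ?thesis by (rule has_monoI[OF _ C'(2,3)]) (use C C'(1) in blast)+
qed

lemma has_mono_mono: "has_mono A E \<chi> \<kappa> n \<Longrightarrow> A \<subseteq> A' \<Longrightarrow> has_mono A' E \<chi> \<kappa> n"
  unfolding has_mono_def by blast

lemma has_mono_emb:
  assumes g: "emb V E V' E' g" and "has_mono V E (\<lambda>e. \<chi> (g ` e)) \<kappa> n"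
  shows "has_mono (g ` V) E' \<chi> \<kappa> n"
  using assms(2)
proof (rule has_monoE)
  fix C assume C: "C \<subseteq> V" "card C = n" "finite C"
    "\<And>x y. x \<in> C \<Longrightarrow> y \<in> C \<Longrightarrow> x \<noteq> y \<Longrightarrow> \<exists>d. {x, y} \<in> E d"
    "\<And>x y. x \<in> C \<Longrightarrow> y \<in> C \<Longrightarrow> x \<noteq> y \<Longrightarrow> \<chi> (g ` {x, y}) = \<kappa>"
  have inj: "inj_on g C" using g C(1) by (auto simp: emb_def intro: inj_on_subset)
  show ?thesis
  proof (rule has_monoI[of "g ` C"])
    show "g ` C \<subseteq> g ` V" "card (g ` C) = n" "finite (g ` C)" using C inj by (auto simp: card_image)
    fix x y assume "x \<in> g ` C" "y \<in> g ` C" "x \<noteq> y"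
    then obtain u v where uv: "u \<in> C" "v \<in> C" "x = g u" "y = g v" "u \<noteq> v" by blast
    show "\<exists>d. {x, y} \<in> E' d" using C(4)[OF uv(1,2,5)] emb_edge[OF g] uv by blast
    show "\<chi> {x, y} = \<kappa>" using C(5)[OF uv(1,2,5)] uv by simp
  qed
qed

subsection \<open>Folkman graphs and the vertex-Ramsey closure\<close>

lemma card_clique_empty: "finite C \<Longrightarrow> clique C {} \<Longrightarrow> card C \<le> 1"
  using card_le_Suc0_iff_eq[of C] by (auto simp: clique_def)

text \<open>Three layers are stacked: copies of a \<open>False\<close> clique of size
  \<open>m\<close> placed in all ways into \<open>N\<close> parts, then homogeneity of vertices,
  then of stars. Read backwards, they yield a copy of the first layer in which the colour of an edge
  depends only on the two parts that it joins. Ramsey's theorem on the set of parts selects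
  \<open>m\<close> parts whose pairs all agree.\<close>

lemma folkman:
  assumes m: "2 \<le> m"
  shows "\<exists>(V :: nat set) E. two_graph (\<lambda>d. if d then 1 else m) V E \<and> (\<forall>\<chi>. \<exists>\<kappa>. has_mono V E \<chi> \<kappa> m)"
proof -
  let ?w = "\<lambda>d. if d then 1 else m"
  define V0 where "V0 = {..<m}"
  define E0 where "E0 d = (if d then {} else nsets V0 2)" for d
  have G0: "two_graph ?w V0 E0"
    unfolding two_graph_def
  proof (intro conjI allI impI)
    fix d C assume C: "C \<subseteq> V0" "clique C (E0 d)"
    have fC: "finite C" using C(1) by (simp add: V0_def finite_subset)
    show "card C \<le> ?w d"
    proof (cases d)
      case True
      then show ?thesis using card_clique_empty[OF fC] C(2) by (simp add: E0_def)
    next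
      case False
      then show ?thesis using card_mono[OF _ C(1)] by (simp add: V0_def)
    qed
  qed (auto simp: E0_def V0_def)
  obtain N :: nat where N: "partn_lst {..<N} [m, m] 2" using ramsey_full by blast
  obtain V1 :: "nat set" and E1 \<pi>1 where 1: "two_graph ?w V1 E1" "partite E1 \<pi>1"
    and copies: "\<forall>\<phi>. inj_on \<phi> V0 \<longrightarrow> \<phi> ` V0 \<subseteq> {..<N} \<longrightarrow>
      (\<exists>g. emb V0 E0 V1 E1 g \<and> (\<forall>x\<in>V0. \<pi>1 (g x) = \<phi> x))"
    using partite_copies[OF G0, of N] by (elim exE conjE)
  \<comment> \<open>The vertices will be coloured by the sets \<open>h\<close> below, hence the
    palette of all sets of parts.\<close>
  have "realizable ?w (Pow {..<N}) V1 E1 \<pi>1 (\<lambda>\<chi>. \<forall>i\<in>{..<N}. vertex_hom i V1 E1 \<pi>1 \<chi>)"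
  proof (rule realizable_Ball[OF finite_lessThan _ _ 1])
    show "realizable ?w (Pow {..<N}) V E \<pi> (vertex_hom i V E \<pi>)"
      if "two_graph ?w V E" "partite E \<pi>" for i V E \<pi>
      by (rule vertex_step[OF that]) (use m in auto)
  qed (rule vertex_hom_pull)
  then obtain V2 :: "nat set" and E2 \<pi>2 where 2: "two_graph ?w V2 E2" "partite E2 \<pi>2"
    and hom2: "\<forall>\<chi>. (\<forall>e. \<chi> e \<in> Pow {..<N}) \<longrightarrow>
      (\<exists>g. pemb V1 E1 \<pi>1 V2 E2 \<pi>2 g \<and> (\<forall>i\<in>{..<N}. vertex_hom i V1 E1 \<pi>1 (\<lambda>e. \<chi> (g ` e))))"
    by (rule realizableE)
  let ?T = "{ij \<in> {..<N} \<times> {..<N}. fst ij \<noteq> snd ij}"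
  have "realizable ?w (UNIV :: bool set) V2 E2 \<pi>2 (\<lambda>\<chi>. \<forall>ij\<in>?T. star_hom ij V2 E2 \<pi>2 \<chi>)"
  proof (rule realizable_Ball[OF _ _ _ 2])
    show "realizable ?w (UNIV :: bool set) V E \<pi> (star_hom ij V E \<pi>)"
      if "ij \<in> ?T" "two_graph ?w V E" "partite E \<pi>" for ij V E \<pi>
      using star_step[OF that(2,3), of "fst ij" "snd ij"] that(1) m by simp
  qed (simp, rule star_hom_pull)
  then obtain V3 :: "nat set" and E3 \<pi>3 where 3: "two_graph ?w V3 E3" "partite E3 \<pi>3"
    and hom3: "\<forall>\<chi>. (\<forall>e. \<chi> e \<in> (UNIV :: bool set)) \<longrightarrow>
      (\<exists>g. pemb V2 E2 \<pi>2 V3 E3 \<pi>3 g \<and> (\<forall>ij\<in>?T. star_hom ij V2 E2 \<pi>2 (\<lambda>e. \<chi> (g ` e))))"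
    by (rule realizableE)
  have "\<exists>\<kappa>. has_mono V3 E3 \<chi> \<kappa> m" for \<chi>
  proof -
    have "\<exists>g. pemb V2 E2 \<pi>2 V3 E3 \<pi>3 g \<and> (\<forall>ij\<in>?T. star_hom ij V2 E2 \<pi>2 (\<lambda>e. \<chi> (g ` e)))"
      using hom3 by simp
    then obtain g3 where g3: "pemb V2 E2 \<pi>2 V3 E3 \<pi>3 g3"
      and star: "\<forall>ij\<in>?T. star_hom ij V2 E2 \<pi>2 (\<lambda>e. \<chi> (g3 ` e))" by (elim exE conjE)
    \<comment> \<open>\<open>h {y}\<close> is the set of parts to which \<open>y\<close> sends edges
      coloured \<open>True\<close>. Since stars are monochromatic, one edge from \<open>y\<close> to
      a part decides.\<close>
    define h where "h e = {i. i < N \<and> (\<exists>x\<in>V2. \<exists>y\<in>e. \<pi>2 x = i \<and> {x, y} \<in> E2 False \<and> \<chi> (g3 ` {x, y}))}"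
      for e :: "nat set"
    have "\<forall>e. h e \<in> Pow {..<N}" by (auto simp: h_def)
    from hom2[THEN spec, THEN mp, OF this]
    obtain g2 where g2: "pemb V1 E1 \<pi>1 V2 E2 \<pi>2 g2"
      and vert: "\<forall>i\<in>{..<N}. vertex_hom i V1 E1 \<pi>1 (\<lambda>e. h (g2 ` e))" by (elim exE conjE)
    \<comment> \<open>The value of \<open>h\<close> shared by the vertices of part \<open>j\<close>,
      read off at any of them; for an empty part it is arbitrary.\<close>
    define hp where "hp j = h {g2 (SOME x. x \<in> V1 \<and> \<pi>1 x = j)}" for j
    have hp: "h {g2 x} = hp (\<pi>1 x)" if x: "x \<in> V1" "\<pi>1 x < N" for x
    proof -
      let ?z = "SOME z. z \<in> V1 \<and> \<pi>1 z = \<pi>1 x"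
      have "?z \<in> V1 \<and> \<pi>1 ?z = \<pi>1 x" using someI[of "\<lambda>z. z \<in> V1 \<and> \<pi>1 z = \<pi>1 x" x] x by simp
      moreover have vh: "vertex_hom (\<pi>1 x) V1 E1 \<pi>1 (\<lambda>e. h (g2 ` e))" using bspec[OF vert, of "\<pi>1 x"] x(2) by simp
      ultimately show ?thesis
        using vh[unfolded vertex_hom_def, rule_format, of x ?z] x(1) by (simp add: hp_def)
    qed
    have e2: "emb V1 E1 V2 E2 g2" "\<And>x. x \<in> V1 \<Longrightarrow> \<pi>2 (g2 x) = \<pi>1 x" using g2 by (auto simp: pemb_def)
    have col: "\<chi> (g3 ` {g2 x, g2 y}) \<longleftrightarrow> \<pi>1 x \<in> hp (\<pi>1 y)"
      if e: "{x, y} \<in> E1 False" and lt: "\<pi>1 x < N" "\<pi>1 y < N" for x y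
    proof -
      have xy: "x \<in> V1" "y \<in> V1" "x \<noteq> y" using two_graph_edgeD[OF 1(1) e] by auto
      have xy2: "g2 x \<in> V2" "g2 y \<in> V2" using emb_in[OF e2(1)] xy by auto
      have e': "{g2 x, g2 y} \<in> E2 False" by (rule emb_edge[OF e2(1) e])
      have "\<pi>1 x \<noteq> \<pi>1 y" by (rule partite_edge[OF 1(2) e xy(3)])
      then have st: "star_hom (\<pi>1 x, \<pi>1 y) V2 E2 \<pi>2 (\<lambda>e. \<chi> (g3 ` e))" using star lt by simp
      have same: "\<chi> (g3 ` {x', g2 y}) = \<chi> (g3 ` {g2 x, g2 y})"
        if "x' \<in> V2" "\<pi>2 x' = \<pi>1 x" "{x', g2 y} \<in> E2 False" for x'
        using st[unfolded star_hom_def, rule_format, of x' "g2 x" "g2 y"] that xy2 e' e2(2) xy by simp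
      have "\<pi>1 x \<in> h {g2 y} \<longleftrightarrow> \<chi> (g3 ` {g2 x, g2 y})"
      proof
        assume "\<pi>1 x \<in> h {g2 y}"
        then obtain x' where "x' \<in> V2" "\<pi>2 x' = \<pi>1 x" "{x', g2 y} \<in> E2 False" "\<chi> (g3 ` {x', g2 y})"
          by (auto simp: h_def)
        then show "\<chi> (g3 ` {g2 x, g2 y})" using same by simp
      next
        assume "\<chi> (g3 ` {g2 x, g2 y})"
        then show "\<pi>1 x \<in> h {g2 y}"
          using lt(1) xy2(1) e' e2(2)[OF xy(1)] unfolding h_def
          by (intro CollectI conjI bexI[of _ "g2 x"] bexI[of _ "g2 y"]) simp_all
      qed
      then show ?thesis using hp[OF xy(2) lt(2)] by simp
    qed
    \<comment> \<open>The colour induced on pairs of parts, with 0 standing for \<open>True\<close>.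
      As \<open>col\<close> holds for either order of the two ends, orienting the pair by
      \<open>Min\<close> and \<open>Max\<close> is a free choice.\<close>
    define c where "c e = (if Min e \<in> hp (Max e) then 0 else 1 :: nat)" for e
    have c: "c \<in> nsets {..<N} 2 \<rightarrow> {..<2}" by (auto simp: c_def)
    obtain i C where C: "i < length [m, m]" "C \<in> nsets {..<N} ([m, m] ! i)" "c ` nsets C 2 \<subseteq> {i}"
      using partn_lstE[OF N c] by auto
    have C': "C \<subseteq> {..<N}" "finite C" "card C = m" using C(1,2) by (auto simp: nsets_def less_Suc_eq)
    obtain \<phi> where \<phi>: "bij_betw \<phi> V0 C"
      using C'(2,3) finite_same_card_bij[of V0 C] by (auto simp: V0_def)
    have \<phi>': "inj_on \<phi> V0" "\<phi> ` V0 \<subseteq> {..<N}" using \<phi> C'(1) by (auto simp: bij_betw_def)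
    from copies[THEN spec, THEN mp, THEN mp, OF \<phi>']
    obtain g1 where g1: "emb V0 E0 V1 E1 g1" "\<forall>x\<in>V0. \<pi>1 (g1 x) = \<phi> x" by (elim exE conjE)
    let ?g = "g3 \<circ> (g2 \<circ> g1)"
    have g: "emb V0 E0 V3 E3 ?g"
      using g3 g2 g1(1) by (auto simp: pemb_def intro: emb_comp)
    have lt_col: "\<chi> (?g ` {x, y}) = (i = 0)" if xy: "x \<in> V0" "y \<in> V0" "\<phi> x < \<phi> y" for x y
    proof -
      have "\<phi> x \<in> C" "\<phi> y \<in> C" using \<phi> xy by (auto simp: bij_betw_def)
      then have "{\<phi> x, \<phi> y} \<in> nsets C 2" using xy(3) by simp
      then have "c {\<phi> x, \<phi> y} = i" using C(3) by blast
      moreover have "Min {\<phi> x, \<phi> y} = \<phi> x" "Max {\<phi> x, \<phi> y} = \<phi> y" using xy(3) by auto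
      ultimately have "\<phi> x \<in> hp (\<phi> y) \<longleftrightarrow> i = 0" by (auto simp: c_def split: if_splits)
      moreover have "{x, y} \<in> E0 False" using xy by (auto simp: E0_def)
      then have "{g1 x, g1 y} \<in> E1 False" by (rule emb_edge[OF g1(1)])
      then have "\<chi> (g3 ` {g2 (g1 x), g2 (g1 y)}) \<longleftrightarrow> \<phi> x \<in> hp (\<phi> y)"
        using col[of "g1 x" "g1 y"] g1(2) xy \<phi>'(2) by auto
      ultimately show ?thesis by simp
    qed
    have "has_mono V0 E0 (\<lambda>e. \<chi> (?g ` e)) (i = 0) m"
    proof (rule has_monoI[of V0])
      fix x y assume xy: "x \<in> V0" "y \<in> V0" "x \<noteq> y"
      show "\<exists>d. {x, y} \<in> E0 d" using xy by (intro exI[of _ False]) (simp add: E0_def)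
      have "\<phi> x \<noteq> \<phi> y" using xy \<phi>'(1) by (simp add: inj_on_eq_iff)
      then consider "\<phi> x < \<phi> y" | "\<phi> y < \<phi> x" by linarith
      then show "\<chi> (?g ` {x, y}) = (i = 0)"
        by cases (use lt_col[of x y] lt_col[of y x] xy in \<open>simp_all add: insert_commute\<close>)
    qed (simp_all add: V0_def)
    from has_mono_emb[OF g this] have "has_mono (?g ` V0) E3 \<chi> (i = 0) m" .
    then have "has_mono V3 E3 \<chi> (i = 0) m"
      by (rule has_mono_mono) (use g in \<open>simp add: emb_def\<close>)
    then show ?thesis by blast
  qed
  then show ?thesis using 3(1) by (intro exI[of _ V3] exI[of _ E3] conjI allI)
qed

text \<open>As in \<open>folkman\<close>, without stars: colours depend only on the part, so
  \<open>card V\<close> of the \<open>card V * card K\<close> parts share a colour, and the copy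
  placed in these is monochromatic. The clique bounds of both exhibited colours are kept.\<close>

lemma vertex_ramsey:
  fixes V :: "nat set" and K :: "'c set"
  assumes G: "two_graph w V E" and w: "\<And>d. 1 \<le> w d" and K: "finite K" "K \<noteq> {}"
  shows "\<exists>(V' :: nat set) E'. two_graph w V' E' \<and>
    (\<forall>h. (\<forall>x. h x \<in> K) \<longrightarrow> (\<exists>g c. emb V E V' E' g \<and> (\<forall>x\<in>V. h (g x) = c)))"
proof -
  define N where "N = card V * card K"
  have fV: "finite V" using two_graphD(1)[OF G] .
  obtain V1 :: "nat set" and E1 \<pi>1 where 1: "two_graph w V1 E1" "partite E1 \<pi>1"
    and copies: "\<forall>\<phi>. inj_on \<phi> V \<longrightarrow> \<phi> ` V \<subseteq> {..<N} \<longrightarrow>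
      (\<exists>g. emb V E V1 E1 g \<and> (\<forall>x\<in>V. \<pi>1 (g x) = \<phi> x))"
    using partite_copies[OF G, of N] by (elim exE conjE)
  have "realizable w K V1 E1 \<pi>1 (\<lambda>\<chi>. \<forall>i\<in>{..<N}. vertex_hom i V1 E1 \<pi>1 \<chi>)"
    by (rule realizable_Ball[OF finite_lessThan vertex_step[OF _ _ w K] vertex_hom_pull 1])
  then obtain V2 :: "nat set" and E2 \<pi>2 where 2: "two_graph w V2 E2" "partite E2 \<pi>2"
    and hom2: "\<forall>\<chi>. (\<forall>e. \<chi> e \<in> K) \<longrightarrow>
      (\<exists>g. pemb V1 E1 \<pi>1 V2 E2 \<pi>2 g \<and> (\<forall>i\<in>{..<N}. vertex_hom i V1 E1 \<pi>1 (\<lambda>e. \<chi> (g ` e))))"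
    by (rule realizableE)
  have "\<exists>g c. emb V E V2 E2 g \<and> (\<forall>x\<in>V. h (g x) = c)" if h: "\<forall>x. h x \<in> K" for h
  proof -
    \<comment> \<open>A vertex colouring is turned into a colouring of sets, read on
      singletons.\<close>
    have "\<forall>e. h (the_elem e) \<in> K" using h by simp
    from hom2[THEN spec, THEN mp, OF this]
    obtain g2 where g2: "pemb V1 E1 \<pi>1 V2 E2 \<pi>2 g2"
      and vert: "\<forall>i\<in>{..<N}. vertex_hom i V1 E1 \<pi>1 (\<lambda>e. h (the_elem (g2 ` e)))" by (elim exE conjE)
    define hp where "hp j = h (g2 (SOME x. x \<in> V1 \<and> \<pi>1 x = j))" for j
    have hp: "h (g2 x) = hp (\<pi>1 x)" if x: "x \<in> V1" "\<pi>1 x < N" for x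
    proof -
      let ?z = "SOME z. z \<in> V1 \<and> \<pi>1 z = \<pi>1 x"
      have "?z \<in> V1 \<and> \<pi>1 ?z = \<pi>1 x" using someI[of "\<lambda>z. z \<in> V1 \<and> \<pi>1 z = \<pi>1 x" x] x by simp
      moreover have vh: "vertex_hom (\<pi>1 x) V1 E1 \<pi>1 (\<lambda>e. h (the_elem (g2 ` e)))" using bspec[OF vert, of "\<pi>1 x"] x(2) by simp
      ultimately show ?thesis
        using vh[unfolded vertex_hom_def, rule_format, of x ?z] x(1) by (simp add: hp_def)
    qed
    have "hp \<in> {..<N} \<rightarrow> K" using h by (simp add: hp_def)
    from pigeonhole_card[OF this finite_lessThan K]
    obtain c where c: "N \<le> card (hp -` {c} \<inter> {..<N}) * card K" by auto
    have "0 < card K" using K by (simp add: card_gt_0_iff)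
    then have "card V \<le> card (hp -` {c} \<inter> {..<N})" using c by (simp add: N_def)
    then obtain \<phi> where \<phi>: "\<phi> ` V \<subseteq> hp -` {c} \<inter> {..<N}" "inj_on \<phi> V"
      using card_le_inj[OF fV, of "hp -` {c} \<inter> {..<N}"] by auto
    have "\<phi> ` V \<subseteq> {..<N}" using \<phi>(1) by auto
    from copies[THEN spec, THEN mp, THEN mp, OF \<phi>(2) this]
    obtain g1 where g1: "emb V E V1 E1 g1" "\<forall>x\<in>V. \<pi>1 (g1 x) = \<phi> x" by (elim exE conjE)
    have "h ((g2 \<circ> g1) x) = c" if "x \<in> V" for x
    proof -
      have "\<phi> x \<in> hp -` {c} \<inter> {..<N}" using \<phi>(1) that by blast
      then show ?thesis using hp[of "g1 x"] emb_in[OF g1(1) that] g1(2) that by simp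
    qed
    moreover have "emb V E V2 E2 (g2 \<circ> g1)"
      by (rule emb_comp[OF g1(1)]) (use g2 in \<open>simp add: pemb_def\<close>)
    ultimately show ?thesis by (intro exI[of _ "g2 \<circ> g1"] exI[of _ c] conjI) simp_all
  qed
  then show ?thesis using 2(1) by (intro exI[of _ V2] exI[of _ E2] conjI allI impI)
qed

text \<open>Disjoint union as an amalgamation over the empty set, every vertex being its own
  part.\<close>

lemma two_graph_Plus:
  fixes V1 V2 :: "nat set"
  assumes "two_graph w V1 E1" "two_graph w V2 E2"
  obtains V :: "nat set" and E g1 g2 where "two_graph w V E" "emb V1 E1 V E g1" "emb V2 E2 V E g2"
proof -
  have id: "partite E id" for E :: "bool \<Rightarrow> nat set set" by (simp add: partite_def)
  have f: "\<forall>i\<in>{()}. inj_on (\<lambda>_. 0 :: nat) {} \<and> (\<lambda>_. 0) ` {} \<subseteq> V2 \<and> partite E1 id \<and> (\<forall>x\<in>{}. id 0 = id x) \<and>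
      (\<forall>d. \<forall>x\<in>{}. \<forall>y\<in>{}. {x, y} \<in> E1 d \<longleftrightarrow> {0, 0} \<in> E2 d)"
    using id by simp
  obtain V :: "nat set" and E \<pi> \<iota> and g :: "unit \<Rightarrow> nat \<Rightarrow> nat" where "two_graph w V E" "partite E \<pi>"
    "emb V2 E2 V E \<iota>" "\<forall>i\<in>{()}. pemb V1 E1 id V E \<pi> (g i) \<and> (\<forall>x\<in>{}. g i x = \<iota> 0)"
    by (rule amalgamation[where f = "\<lambda>_ _. 0" and p = "\<lambda>_. id", OF assms(1) empty_subsetI assms(2) id _ f]) simp
  then show thesis by (intro that[of V E "g ()" \<iota>]) (simp_all add: pemb_def)
qed

text \<open>Recolouring by agreement with \<open>\<kappa>\<close> keeps or swaps the colours. An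
  arrow proved for all colourings with \<open>True\<close> in the first role thus holds with either
  colour in that role.\<close>

lemma has_mono_eq: "has_mono A E (\<lambda>e. \<chi> e = \<kappa>) d n \<longleftrightarrow> has_mono A E \<chi> (\<kappa> = d) n"
proof -
  have "{e \<in> \<Union>(range E). (\<chi> e = \<kappa>) = d} = {e \<in> \<Union>(range E). \<chi> e = (\<kappa> = d)}" by auto
  then show ?thesis by (simp add: has_mono_def)
qed

subsection \<open>Joins with a clique\<close>

text \<open>The colour across is a parameter because \<open>asymmetric_arrow\<close> joins by
  \<open>True\<close> edges and the final graph by \<open>False\<close> ones.\<close>

definition join_edges :: "nat \<Rightarrow> bool \<Rightarrow> nat set \<Rightarrow> (bool \<Rightarrow> nat set set) \<Rightarrow> bool \<Rightarrow> nat set set" where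
  "join_edges p d V E d' = E d' \<union> (if d' = d then {{s, x} |s x. s < p \<and> x \<in> V} else nsets {..<p} 2)"

lemma join_edges_cases:
  assumes "two_graph w V E" and "V \<inter> {..<p} = {}"
  shows "x \<in> V \<Longrightarrow> y \<in> V \<Longrightarrow> {x, y} \<in> join_edges p d V E d' \<longleftrightarrow> {x, y} \<in> E d'"
    and "s < p \<Longrightarrow> s' < p \<Longrightarrow> s \<noteq> s' \<Longrightarrow> {s, s'} \<in> join_edges p d V E d' \<longleftrightarrow> d' = (\<not> d)"
    and "s < p \<Longrightarrow> x \<in> V \<Longrightarrow> {s, x} \<in> join_edges p d V E d' \<longleftrightarrow> d' = d"
proof -
  define S T where "S = {{s, x} |s x. s < p \<and> x \<in> V}" and "T = nsets {..<p} 2"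
  have je: "e \<in> join_edges p d V E d' \<longleftrightarrow> e \<in> E d' \<or> (if d' = d then e \<in> S else e \<in> T)" for e
    by (simp add: join_edges_def S_def T_def)
  have not_E: "{s, y} \<notin> E d'" if "s < p" for s y
  proof
    assume "{s, y} \<in> E d'"
    from two_graph_edgeD(1)[OF assms(1) this] show False using assms(2) that by auto
  qed
  have out: "\<not> z < p" if "z \<in> V" for z using assms(2) that by auto
  show "{x, y} \<in> join_edges p d V E d' \<longleftrightarrow> {x, y} \<in> E d'" if "x \<in> V" "y \<in> V"
  proof -
    have "{x, y} \<notin> S" "{x, y} \<notin> T"
      unfolding S_def T_def using out that by (auto simp: doubleton_eq_iff)
    then show ?thesis by (simp add: je)
  qed
  show "{s, s'} \<in> join_edges p d V E d' \<longleftrightarrow> d' = (\<not> d)" if "s < p" "s' < p" "s \<noteq> s'"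
  proof -
    have "{s, s'} \<notin> S" "{s, s'} \<in> T"
      unfolding S_def T_def using out that by (auto simp: doubleton_eq_iff)
    then show ?thesis using not_E[OF that(1)] by (simp add: je)
  qed
  show "{s, x} \<in> join_edges p d V E d' \<longleftrightarrow> d' = d" if "s < p" "x \<in> V"
  proof -
    have "{s, x} \<in> S" "{s, x} \<notin> T"
      unfolding S_def T_def using out that by auto
    then show ?thesis using not_E[OF that(1)] by (simp add: je)
  qed
qed

lemma join_edges_nsets:
  assumes "two_graph w V E" "V \<inter> {..<p} = {}"
  shows "join_edges p d V E d' \<subseteq> nsets ({..<p} \<union> V) 2"
proof -
  have "E d' \<subseteq> nsets ({..<p} \<union> V) 2" using two_graphD(2)[OF assms(1), of d'] nsets_mono[of V "{..<p} \<union> V" 2] by simp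
  moreover have "nsets {..<p} 2 \<subseteq> nsets ({..<p} \<union> V) 2" by (rule nsets_mono) simp
  moreover have "{{s, x} |s x. s < p \<and> x \<in> V} \<subseteq> nsets ({..<p} \<union> V) 2" using assms(2) by auto
  ultimately show ?thesis by (simp add: join_edges_def)
qed

text \<open>Colour \<open>d\<close> is absent inside \<open>{..<p}\<close>, so a clique takes at
  most one vertex there.\<close>

lemma join_clique_across:
  assumes G: "two_graph w V E" "V \<inter> {..<p} = {}" and C: "C \<subseteq> {..<p} \<union> V" "clique C (join_edges p d V E d)"
  shows "card C \<le> w d + 1"
proof -
  have fC: "finite C" using C(1) two_graphD(1)[OF G(1)] finite_subset by blast
  have "s = s'" if "s \<in> C \<inter> {..<p}" "s' \<in> C \<inter> {..<p}" for s s'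
  proof (rule ccontr)
    assume "s \<noteq> s'"
    then show False
      using cliqueD[OF C(2), of s s'] join_edges_cases(2)[OF G, of s s' d d] that by simp
  qed
  then have "card (C \<inter> {..<p}) \<le> 1"
    using card_le_Suc0_iff_eq[of "C \<inter> {..<p}"] fC by simp
  moreover have "clique (C \<inter> V) (E d)"
  proof (rule cliqueI)
    fix x y assume "x \<in> C \<inter> V" "y \<in> C \<inter> V" "x \<noteq> y"
    then show "{x, y} \<in> E d"
      using cliqueD[OF C(2), of x y] join_edges_cases(1)[OF G, of x y d d] by simp
  qed
  then have "card (C \<inter> V) \<le> w d" using two_graphD(3)[OF G(1)] by simp
  moreover have "C = (C \<inter> {..<p}) \<union> (C \<inter> V)" using C(1) by auto
  then have "card C \<le> card (C \<inter> {..<p}) + card (C \<inter> V)" by (metis card_Un_le)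
  ultimately show ?thesis by linarith
qed

text \<open>The other colour never crosses, so a clique stays on one side.\<close>

lemma join_clique_within:
  assumes G: "two_graph w V E" "V \<inter> {..<p} = {}"
    and C: "C \<subseteq> {..<p} \<union> V" "clique C (join_edges p d V E (\<not> d))"
  shows "C \<subseteq> {..<p} \<or> card C \<le> w (\<not> d)"
proof (cases "C \<subseteq> {..<p}")
  case False
  then obtain x where x: "x \<in> C" "x \<in> V" using C(1) by auto
  have "s \<notin> {..<p}" if "s \<in> C" for s
  proof
    assume s: "s \<in> {..<p}"
    then have "s \<noteq> x" using x G(2) by auto
    then have "{s, x} \<in> join_edges p d V E (\<not> d)" using cliqueD[OF C(2) that x(1)] by simp
    then show False using join_edges_cases(3)[OF G, of s x d "\<not> d"] s x by simp
  qed
  then have CV: "C \<subseteq> V" using C(1) by auto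
  have "clique C (E (\<not> d))"
  proof (rule cliqueI)
    fix x y assume xy: "x \<in> C" "y \<in> C" "x \<noteq> y"
    then have "x \<in> V" "y \<in> V" using CV by auto
    then show "{x, y} \<in> E (\<not> d)"
      using cliqueD[OF C(2) xy] join_edges_cases(1)[OF G, of x y d "\<not> d"] by simp
  qed
  then show ?thesis using two_graphD(3)[OF G(1) CV] by simp
qed simp

lemma has_mono_join:
  assumes G: "two_graph w V E" "V \<inter> {..<p} = {}" and X: "X \<subseteq> V" and C: "C \<subseteq> {..<p}"
    and CC: "\<And>s s'. s \<in> C \<Longrightarrow> s' \<in> C \<Longrightarrow> s \<noteq> s' \<Longrightarrow> \<chi> {s, s'} = \<kappa>"
    and CX: "\<And>s x. s \<in> C \<Longrightarrow> x \<in> X \<Longrightarrow> \<chi> {s, x} = \<kappa>"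
    and m: "has_mono X E \<chi> \<kappa> n"
  shows "has_mono ({..<p} \<union> V) (join_edges p d V E) \<chi> \<kappa> (card C + n)"
  using m
proof (rule has_monoE)
  fix B assume B: "B \<subseteq> X" "card B = n" "finite B"
    "\<And>x y. x \<in> B \<Longrightarrow> y \<in> B \<Longrightarrow> x \<noteq> y \<Longrightarrow> \<exists>d. {x, y} \<in> E d"
    "\<And>x y. x \<in> B \<Longrightarrow> y \<in> B \<Longrightarrow> x \<noteq> y \<Longrightarrow> \<chi> {x, y} = \<kappa>"
  have BV: "B \<subseteq> V" using B(1) X by blast
  have fC: "finite C" using C finite_subset by blast
  have "C \<inter> B = {}" using C BV G(2) by auto
  show ?thesis
  proof (rule has_monoI[of "C \<union> B"])
    show "card (C \<union> B) = card C + n" using fC B(2,3) \<open>C \<inter> B = {}\<close> by (simp add: card_Un_disjoint)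
    fix x y assume xy: "x \<in> C \<union> B" "y \<in> C \<union> B" "x \<noteq> y"
    consider "x \<in> C" "y \<in> C" | "x \<in> C" "y \<in> B" | "y \<in> C" "x \<in> B" | "x \<in> B" "y \<in> B" using xy by blast
    then show "\<exists>d'. {x, y} \<in> join_edges p d V E d'"
    proof cases
      case 1
      then show ?thesis using join_edges_cases(2)[OF G, of x y d "\<not> d"] C xy(3) by (intro exI[of _ "\<not> d"]) auto
    next
      case 2
      then show ?thesis using join_edges_cases(3)[OF G, of x y d d] C BV by (intro exI[of _ d]) auto
    next
      case 3
      then show ?thesis using join_edges_cases(3)[OF G, of y x d d] C BV
        by (intro exI[of _ d]) (auto simp: insert_commute)
    next
      case 4
      then obtain d' where "{x, y} \<in> E d'" using B(4) xy(3) by metis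
      then show ?thesis using join_edges_cases(1)[OF G, of x y d d'] 4 BV by (intro exI[of _ d']) auto
    qed
    from \<open>x \<in> C \<union> B\<close> \<open>y \<in> C \<union> B\<close> show "\<chi> {x, y} = \<kappa>"
      using CC[of x y] CX[of x y] CX[of y x] B(5)[of x y] B(1) xy(3) by (auto simp: insert_commute)
  qed (use C BV fC B in auto)
qed

section \<open>Gadgets and the asymmetric arrow\<close>

text \<open>Take the vertex-Ramsey closure of the disjoint union of the given graph and a Folkman
  graph, a vertex being coloured by the set of \<open>s < p\<close> that send it
  \<open>True\<close>. On a homogeneous copy \<open>X\<close> the colour of \<open>{s, x}\<close> is
  a function \<open>\<eta>\<close> of \<open>s\<close> alone, while both arrows remain available
  inside \<open>X\<close>, the first with either colour in the role of \<open>True\<close>.\<close>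

lemma gadget:
  assumes m: "2 \<le> m" and a: "1 \<le> a"
    and F: "two_graph (\<lambda>d. if d then a else m) (VF :: nat set) EF"
    and arrow: "\<And>\<chi>. has_mono VF EF \<chi> True a \<or> has_mono VF EF \<chi> False k"
  obtains V :: "nat set" and E where "V \<inter> {..<p} = {}" "two_graph (\<lambda>d. if d then a else m) V E"
    "\<forall>\<chi>. \<exists>X \<eta>. X \<subseteq> V \<and> (\<forall>s<p. \<forall>x\<in>X. \<chi> {s, x} = \<eta> s) \<and>
      (\<forall>\<kappa>. has_mono X E \<chi> \<kappa> a \<or> has_mono X E \<chi> (\<not> \<kappa>) k) \<and> (\<exists>\<kappa>. has_mono X E \<chi> \<kappa> m)"
proof -
  let ?w = "\<lambda>d. if d then a else m"
  obtain VM :: "nat set" and EM where M: "two_graph (\<lambda>d. if d then 1 else m) VM EM"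
      "\<forall>\<chi>. \<exists>\<kappa>. has_mono VM EM \<chi> \<kappa> m"
    using folkman[OF m] by (elim exE conjE)
  have M': "two_graph ?w VM EM" by (rule two_graph_mono[OF M(1)]) (use a in simp)
  obtain U :: "nat set" and EU gF gM where U: "two_graph ?w U EU" "emb VF EF U EU gF" "emb VM EM U EU gM"
    by (rule two_graph_Plus[OF F M'])
  have w: "1 \<le> ?w d" for d using m a by simp
  have K: "finite (Pow {..<p})" "Pow {..<p} \<noteq> {}" by auto
  obtain Q :: "nat set" and EQ where Q: "two_graph ?w Q EQ"
    and ram: "\<forall>h. (\<forall>x. h x \<in> Pow {..<p}) \<longrightarrow> (\<exists>g c. emb U EU Q EQ g \<and> (\<forall>x\<in>U. h (g x) = c))"
    using vertex_ramsey[OF U(1) w K] by (elim exE conjE)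
  \<comment> \<open>Shifting by \<open>p\<close> frees the vertices \<open>{..<p}\<close> for the
    clique of a later join.\<close>
  define sh where "sh = (\<lambda>x :: nat. x + p)"
  have sh: "inj_on sh Q" by (simp add: sh_def)
  let ?V = "sh ` Q" and ?E = "\<lambda>d. (`) sh ` EQ d"
  have V: "two_graph ?w ?V ?E" and eV: "emb Q EQ ?V ?E sh" by (rule relabel[OF Q sh])+
  have "\<exists>X \<eta>. X \<subseteq> ?V \<and> (\<forall>s<p. \<forall>x\<in>X. \<chi> {s, x} = \<eta> s) \<and>
      (\<forall>\<kappa>. has_mono X ?E \<chi> \<kappa> a \<or> has_mono X ?E \<chi> (\<not> \<kappa>) k) \<and> (\<exists>\<kappa>. has_mono X ?E \<chi> \<kappa> m)" for \<chi>
  proof -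
    define h where "h x = {s. s < p \<and> \<chi> {s, sh x}}" for x
    have "\<forall>x. h x \<in> Pow {..<p}" by (auto simp: h_def)
    from ram[THEN spec, THEN mp, OF this]
    obtain g c where g: "emb U EU Q EQ g" "\<forall>x\<in>U. h (g x) = c" by (elim exE conjE)
    let ?f = "sh \<circ> g"
    have f: "emb U EU ?V ?E ?f" by (rule emb_comp[OF g(1) eV])
    have fF: "emb VF EF ?V ?E (?f \<circ> gF)" by (rule emb_comp[OF U(2) f])
    have fM: "emb VM EM ?V ?E (?f \<circ> gM)" by (rule emb_comp[OF U(3) f])
    have subF: "(?f \<circ> gF) ` VF \<subseteq> ?f ` U" and subM: "(?f \<circ> gM) ` VM \<subseteq> ?f ` U"
      using emb_in[OF U(2)] emb_in[OF U(3)] by auto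
    have "?f ` U \<subseteq> ?V" using emb_in[OF f] by blast
    moreover have "\<chi> {s, x} = (s \<in> c)" if "s < p" "x \<in> ?f ` U" for s x
      using g(2) that by (auto simp: h_def)
    moreover have "has_mono (?f ` U) ?E \<chi> \<kappa> a \<or> has_mono (?f ` U) ?E \<chi> (\<not> \<kappa>) k" for \<kappa>
    proof -
      have "has_mono VF EF (\<lambda>e. \<chi> ((?f \<circ> gF) ` e)) \<kappa> a \<or> has_mono VF EF (\<lambda>e. \<chi> ((?f \<circ> gF) ` e)) (\<not> \<kappa>) k"
        using arrow[of "\<lambda>e. \<chi> ((?f \<circ> gF) ` e) = \<kappa>"] unfolding has_mono_eq by simp
      then show ?thesis using has_mono_emb[OF fF] has_mono_mono[OF _ subF] by metis
    qed
    moreover have "\<exists>\<kappa>. has_mono (?f ` U) ?E \<chi> \<kappa> m"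
    proof -
      obtain \<kappa> where "has_mono VM EM (\<lambda>e. \<chi> ((?f \<circ> gM) ` e)) \<kappa> m" using M(2) by metis
      from has_mono_mono[OF has_mono_emb[OF fM this] subM] show ?thesis by blast
    qed
    ultimately show ?thesis by (intro exI[of _ "?f ` U"] exI[of _ "\<lambda>s. s \<in> c"] conjI allI ballI impI) simp_all
  qed
  moreover have "?V \<inter> {..<p} = {}" by (auto simp: sh_def)
  ultimately show thesis using V by (intro that[of ?V ?E] allI)
qed

text \<open>Induction on \<open>a\<close>, joining a \<open>False\<close> clique of size
  \<open>m\<close> by \<open>True\<close> edges to a gadget for \<open>a\<close>: the
  \<open>True\<close> clique bound rises by one, the \<open>False\<close> one stays
  \<open>m\<close>. If \<open>\<chi>\<close> avoids both wanted cliques, it is \<open>False\<close>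
  on all edges to \<open>X\<close>, where it also has a \<open>False\<close> clique of size
  \<open>m\<close>. This forces \<open>\<chi>\<close> to be \<open>True\<close> on the whole joined
  clique, whose size \<open>m\<close> is at least \<open>a + 1\<close>.\<close>

lemma asymmetric_arrow:
  assumes m: "2 \<le> m" and a: "1 \<le> a" "a \<le> m"
  shows "\<exists>(V :: nat set) E. two_graph (\<lambda>d. if d then a else m) V E \<and>
    (\<forall>\<chi>. has_mono V E \<chi> True a \<or> has_mono V E \<chi> False (m + 2))"
  using a
proof (induction a rule: nat_induct_at_least)
  case base
  let ?E = "\<lambda>d :: bool. {} :: nat set set"
  have "two_graph (\<lambda>d. if d then 1 else m) {0 :: nat} ?E"
    unfolding two_graph_def
  proof (intro conjI allI impI)
    fix d and C :: "nat set" assume C: "C \<subseteq> {0}"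
    have "card C \<le> 1" using card_mono[OF _ C] by simp
    then show "card C \<le> (if d then 1 else m)" using m by simp
  qed auto
  moreover have "has_mono {0} ?E \<chi> True 1" for \<chi>
    by (rule has_monoI[of "{0}"]) auto
  ultimately show ?case by (intro exI[of _ "{0}"] exI[of _ ?E] conjI allI disjI1)
next
  case (Suc a)
  let ?w = "\<lambda>d. if d then a else m" and ?k = "m + 2"
  obtain VF :: "nat set" and EF where F: "two_graph ?w VF EF"
      "\<forall>\<chi>. has_mono VF EF \<chi> True a \<or> has_mono VF EF \<chi> False ?k"
    using Suc.IH[OF Suc_leD[OF Suc.prems]] by (elim exE conjE)
  have "has_mono VF EF \<chi> True a \<or> has_mono VF EF \<chi> False ?k" for \<chi> using F(2) by simp
  then obtain V :: "nat set" and E where V: "V \<inter> {..<m} = {}" "two_graph ?w V E"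
    and adv: "\<forall>\<chi>. \<exists>X \<eta>. X \<subseteq> V \<and> (\<forall>s<m. \<forall>x\<in>X. \<chi> {s, x} = \<eta> s) \<and>
      (\<forall>\<kappa>. has_mono X E \<chi> \<kappa> a \<or> has_mono X E \<chi> (\<not> \<kappa>) ?k) \<and> (\<exists>\<kappa>. has_mono X E \<chi> \<kappa> m)"
    by (rule gadget[OF m Suc.hyps F(1), where p = m])
  let ?W = "{..<m} \<union> V" and ?J = "join_edges m True V E"
  have "two_graph (\<lambda>d. if d then Suc a else m) ?W ?J"
    unfolding two_graph_def
  proof (intro conjI allI impI)
    show "finite ?W" using two_graphD(1)[OF V(2)] by simp
    show "?J d \<subseteq> nsets ?W 2" for d by (rule join_edges_nsets[OF V(2,1)])
    fix d C assume C: "C \<subseteq> ?W" "clique C (?J d)"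
    show "card C \<le> (if d then Suc a else m)"
    proof (cases d)
      case True
      then show ?thesis using join_clique_across[OF V(2,1), of C True] C by simp
    next
      case False
      then have "C \<subseteq> {..<m} \<or> card C \<le> m" using join_clique_within[OF V(2,1), of C True] C by simp
      then show ?thesis using False card_mono[of "{..<m}" C] by auto
    qed
  qed
  moreover have "has_mono ?W ?J \<chi> True (Suc a) \<or> has_mono ?W ?J \<chi> False ?k" for \<chi>
  proof (rule ccontr)
    assume no: "\<not> (has_mono ?W ?J \<chi> True (Suc a) \<or> has_mono ?W ?J \<chi> False ?k)"
    obtain X \<eta> \<kappa> where X: "X \<subseteq> V" "\<forall>s<m. \<forall>x\<in>X. \<chi> {s, x} = \<eta> s"
      "\<forall>\<kappa>. has_mono X E \<chi> \<kappa> a \<or> has_mono X E \<chi> (\<not> \<kappa>) ?k" "has_mono X E \<chi> \<kappa> m"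
      using adv[THEN spec, of \<chi>] by (elim exE conjE)
    have up: "has_mono ?W ?J \<chi> \<kappa> (card C + n)"
      if "C \<subseteq> {..<m}" "\<And>s s'. s \<in> C \<Longrightarrow> s' \<in> C \<Longrightarrow> s \<noteq> s' \<Longrightarrow> \<chi> {s, s'} = \<kappa>"
        "\<And>s. s \<in> C \<Longrightarrow> \<eta> s = \<kappa>" "has_mono X E \<chi> \<kappa> n" for C \<kappa> n
      by (rule has_mono_join[OF V(2,1) X(1) that(1,2) _ that(4)]) (use X(2) that(1,3) in auto)
    \<comment> \<open>Otherwise \<open>X\<close> itself has a \<open>False\<close> clique of size
      \<open>m + 2\<close>.\<close>
    have "has_mono X E \<chi> True a"
      using X(3)[THEN spec, of True] up[of "{}" False ?k] no by auto
    then have "\<not> \<eta> s" if "s < m" for s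
      using up[of "{s}" True a] that no by auto
    then have \<eta>: "\<eta> s = False" if "s < m" for s using that by simp
    have "\<kappa> = False"
    proof (rule ccontr)
      assume "\<kappa> \<noteq> False"
      then have "has_mono ?W ?J \<chi> True m" using up[of "{}" True m] X(4) by simp
      then show False using has_mono_le no Suc.prems by blast
    qed
    \<comment> \<open>Two vertices joined by \<open>False\<close> would complete the
      \<open>False\<close> clique of size \<open>m\<close> in \<open>X\<close> to size
      \<open>m + 2\<close>; this is where the 2 comes from.\<close>
    have "\<chi> {s, s'}" if "s < m" "s' < m" "s \<noteq> s'" for s s'
    proof (rule ccontr)
      assume "\<not> \<chi> {s, s'}"
      then have "has_mono ?W ?J \<chi> False (card {s, s'} + m)"
        by (intro up) (use that \<eta> X(4) \<open>\<kappa> = False\<close> in \<open>auto simp: insert_commute\<close>)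
      then show False using no that(3) by simp
    qed
    then have "has_mono ?W ?J \<chi> True m"
      by (intro has_monoI[of "{..<m}"]) (use join_edges_cases(2)[OF V(2,1)] in auto)
    then show False using has_mono_le no Suc.prems by blast
  qed
  ultimately show ?case by (intro exI[of _ ?W] exI[of _ ?J] conjI allI)
qed

section \<open>The graph that separates the two targets\<close>

text \<open>Either colour may take the first role, since in the application \<open>\<kappa>\<close>
  is whichever colour the Folkman clique has.\<close>

lemma ramsey_on_set:
  fixes \<chi> :: "nat set \<Rightarrow> bool"
  assumes R: "partn_lst {..<R} [k, s] 2" and T: "finite T" "R \<le> card T"
  shows "(\<exists>C\<subseteq>T. card C = k \<and> (\<forall>x\<in>C. \<forall>y\<in>C. x \<noteq> y \<longrightarrow> \<chi> {x, y} = \<kappa>)) \<or>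
    (\<exists>C\<subseteq>T. card C = s \<and> (\<forall>x\<in>C. \<forall>y\<in>C. x \<noteq> y \<longrightarrow> \<chi> {x, y} = (\<not> \<kappa>)))"
proof -
  obtain f where f: "f ` {..<R} \<subseteq> T" "inj_on f {..<R}"
    using card_le_inj[of "{..<R}" T] T by auto
  define c where "c e = (if \<chi> (f ` e) = \<kappa> then 0 else 1 :: nat)" for e
  have c: "c \<in> nsets {..<R} 2 \<rightarrow> {..<2}" by (auto simp: c_def)
  obtain i C where C: "i < length [k, s]" "C \<in> nsets {..<R} ([k, s] ! i)" "c ` nsets C 2 \<subseteq> {i}"
    using partn_lstE[OF R c] by auto
  have CR: "C \<subseteq> {..<R}" "card C = [k, s] ! i" using C(2) by (auto simp: nsets_def)
  have inj: "inj_on f C" using f(2) CR(1) by (rule inj_on_subset)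
  have col: "\<chi> {x, y} = (if i = 0 then \<kappa> else \<not> \<kappa>)" if xy: "x \<in> f ` C" "y \<in> f ` C" "x \<noteq> y" for x y
  proof -
    obtain u v where uv: "u \<in> C" "v \<in> C" "u \<noteq> v" "x = f u" "y = f v" using xy by blast
    then have "{u, v} \<in> nsets C 2" by simp
    then have "c {u, v} = i" using C(3) by blast
    then show ?thesis using uv by (auto simp: c_def split: if_splits)
  qed
  have sub: "f ` C \<subseteq> T" using f(1) CR(1) by blast
  have "card (f ` C) = [k, s] ! i" using CR(2) inj by (simp add: card_image)
  moreover have "i = 0 \<or> i = 1" using C(1) by auto
  ultimately show ?thesis using col sub by (elim disjE) (intro disjI1 disjI2 exI[of _ "f ` C"]; auto)+
qed

lemma has_mono_copy_complete:
  assumes "has_mono V E c \<kappa> k"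
  shows "has_mono_copy (V, \<Union>(range E)) c (complete_graph k)"
  using assms
proof (rule has_monoE)
  fix C assume C: "C \<subseteq> V" "card C = k" "finite C"
    "\<And>x y. x \<in> C \<Longrightarrow> y \<in> C \<Longrightarrow> x \<noteq> y \<Longrightarrow> \<exists>d. {x, y} \<in> E d"
    "\<And>x y. x \<in> C \<Longrightarrow> y \<in> C \<Longrightarrow> x \<noteq> y \<Longrightarrow> c {x, y} = \<kappa>"
  obtain \<phi> where \<phi>: "bij_betw \<phi> {..<k} C"
    using finite_same_card_bij[of "{..<k}" C] C(2,3) by auto
  have "\<phi> ` e \<in> \<Union>(range E) \<and> c (\<phi> ` e) = \<kappa>" if e: "e \<in> nsets {..<k} 2" for e
  proof -
    obtain x y where xy: "e = {x, y}" "x \<in> {..<k}" "y \<in> {..<k}" "x \<noteq> y" using e by (rule nsets2_E)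
    then have "\<phi> x \<in> C" "\<phi> y \<in> C" "\<phi> x \<noteq> \<phi> y" using \<phi> by (auto simp: bij_betw_def inj_on_eq_iff)
    then show ?thesis using C(4)[of "\<phi> x" "\<phi> y"] C(5)[of "\<phi> x" "\<phi> y"] xy(1) by auto
  qed
  moreover have "inj_on \<phi> {..<k}" "\<phi> ` {..<k} \<subseteq> V" using \<phi> C(1) by (auto simp: bij_betw_def)
  ultimately show ?thesis
    unfolding has_mono_copy_def complete_graph_def by (intro exI[of _ \<kappa>] exI[of _ \<phi>]) simp
qed

text \<open>Here \<open>{..<p}\<close> is the set \<open>S\<close> and \<open>V\<close> the graph
  \<open>Q\<close> of the outline. By the assumption on \<open>f\<close>, the disjoint union has at
  least \<open>k + R\<close> vertices, too many for \<open>{..<p}\<close>.\<close>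

lemma not_ramsey_equivalent:
  fixes k t f :: nat
  assumes t: "t \<ge> 3" and k: "k > t" and f: "ramsey_number k (k - t + 1) \<le> f * t"
  shows "\<not> ramsey_equivalent (complete_graph k)
    (disjoint_union (complete_graph k) (copies f (complete_graph t)))"
proof -
  define R where "R = ramsey_number k (k - t + 1)"
  define m where "m = k - 2"
  define a where "a = t - 1"
  \<comment> \<open>Large enough that \<open>R\<close> vertices remain after removing at most
    \<open>k - 1\<close>, and still smaller than \<open>k + f * t\<close>.\<close>
  define p where "p = R + k - 1"
  have num: "2 \<le> m" "1 \<le> a" "a \<le> m" "k = m + 2" "t = a + 1" "0 < k"
    using t k by (auto simp: m_def a_def)
  let ?w = "\<lambda>d. if d then a else m"
  obtain VF :: "nat set" and EF where F: "two_graph ?w VF EF"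
      "\<forall>\<chi>. has_mono VF EF \<chi> True a \<or> has_mono VF EF \<chi> False k"
    using asymmetric_arrow[OF num(1-3)] unfolding num(4)[symmetric] by (elim exE conjE)
  have "has_mono VF EF \<chi> True a \<or> has_mono VF EF \<chi> False k" for \<chi> using F(2) by simp
  then obtain V :: "nat set" and E where V: "V \<inter> {..<p} = {}" "two_graph ?w V E"
    and adv: "\<forall>\<chi>. \<exists>X \<eta>. X \<subseteq> V \<and> (\<forall>s<p. \<forall>x\<in>X. \<chi> {s, x} = \<eta> s) \<and>
      (\<forall>\<kappa>. has_mono X E \<chi> \<kappa> a \<or> has_mono X E \<chi> (\<not> \<kappa>) k) \<and> (\<exists>\<kappa>. has_mono X E \<chi> \<kappa> m)"
    by (rule gadget[OF num(1,2) F(1), where p = p])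
  define W where "W = {..<p} \<union> V"
  define J where "J = join_edges p False V E"
  define G where "G = (W, \<Union>(range J))"
  have J: "J d \<subseteq> nsets W 2" for d unfolding J_def W_def by (rule join_edges_nsets[OF V(2,1)])
  have "simple_graph G"
    using J two_graphD(1)[OF V(2)] by (auto simp: simple_graph_def G_def W_def)
  moreover have "ramsey_for G (complete_graph k)"
    unfolding ramsey_for_def
  proof (intro allI, rule ccontr)
    fix \<chi> assume no_copy: "\<not> has_mono_copy G \<chi> (complete_graph k)"
    have no: "\<not> has_mono W J \<chi> \<kappa> k" for \<kappa>
      using has_mono_copy_complete[of W J \<chi> \<kappa> k] no_copy by (auto simp: G_def)
    obtain X \<eta> \<kappa> where X: "X \<subseteq> V" "\<forall>s<p. \<forall>x\<in>X. \<chi> {s, x} = \<eta> s"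
      "\<forall>\<kappa>. has_mono X E \<chi> \<kappa> a \<or> has_mono X E \<chi> (\<not> \<kappa>) k" "has_mono X E \<chi> \<kappa> m"
      using adv[THEN spec, of \<chi>] by (elim exE conjE)
    have up: "has_mono W J \<chi> \<kappa> (card C + n)"
      if "C \<subseteq> {..<p}" "\<And>s s'. s \<in> C \<Longrightarrow> s' \<in> C \<Longrightarrow> s \<noteq> s' \<Longrightarrow> \<chi> {s, s'} = \<kappa>"
        "\<And>s. s \<in> C \<Longrightarrow> \<eta> s = \<kappa>" "has_mono X E \<chi> \<kappa> n" for C \<kappa> n
      unfolding W_def J_def
      by (rule has_mono_join[OF V(2,1) X(1) that(1,2) _ that(4)]) (use X(2) that(1,3) in auto)
    have clique_S: "has_mono W J \<chi> \<kappa> (card C)"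
      if C: "C \<subseteq> {..<p}" "\<And>s s'. s \<in> C \<Longrightarrow> s' \<in> C \<Longrightarrow> s \<noteq> s' \<Longrightarrow> \<chi> {s, s'} = \<kappa>" for C \<kappa>
    proof (rule has_monoI[of C])
      show "C \<subseteq> W" "finite C" using C(1) finite_subset by (auto simp: W_def)
      fix s s' assume s: "s \<in> C" "s' \<in> C" "s \<noteq> s'"
      then show "\<chi> {s, s'} = \<kappa>" by (rule C(2))
      show "\<exists>d. {s, s'} \<in> J d"
        using join_edges_cases(2)[OF V(2,1), of s s' False True] s C(1) by (intro exI[of _ True]) (auto simp: J_def)
    qed simp
    \<comment> \<open>\<open>\<kappa>\<close> is the colour of a clique of size \<open>k - 2\<close>
      in \<open>X\<close>. Two vertices of \<open>S\<close> joined by \<open>\<kappa>\<close> would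
      complete it to size \<open>k\<close>, so \<open>S\<close> is a clique in the other colour and
      has fewer than \<open>k\<close> vertices.\<close>
    define S where "S = {s. s < p \<and> \<eta> s = \<kappa>}"
    define T where "T = {s. s < p \<and> \<eta> s = (\<not> \<kappa>)}"
    have S: "S \<subseteq> {..<p}" and T: "T \<subseteq> {..<p}" by (auto simp: S_def T_def)
    have "\<chi> {s, s'} = (\<not> \<kappa>)" if s: "s \<in> S" "s' \<in> S" "s \<noteq> s'" for s s'
    proof (rule ccontr)
      assume "\<chi> {s, s'} \<noteq> (\<not> \<kappa>)"
      then have "has_mono W J \<chi> \<kappa> (card {s, s'} + m)"
        by (intro up X(4)) (use s in \<open>auto simp: S_def insert_commute\<close>)
      then show False using no s(3) num(4) by simp
    qed
    then have "has_mono W J \<chi> (\<not> \<kappa>) (card S)" by (intro clique_S S)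
    then have "card S < k" using no has_mono_le by (meson not_le)
    moreover have "card S + card T = p"
    proof -
      have "S \<union> T = {..<p}" "S \<inter> T = {}" by (auto simp: S_def T_def)
      then show ?thesis using card_Un_disjoint[of S T] S T finite_subset by (metis card_lessThan finite_lessThan)
    qed
    ultimately have "R \<le> card T" using num(6) by (simp add: p_def)
    moreover have "finite T" using T finite_subset by blast
    ultimately consider C where "C \<subseteq> T" "card C = k" "\<forall>x\<in>C. \<forall>y\<in>C. x \<noteq> y \<longrightarrow> \<chi> {x, y} = \<kappa>"
      | C where "C \<subseteq> T" "card C = k - t + 1" "\<forall>x\<in>C. \<forall>y\<in>C. x \<noteq> y \<longrightarrow> \<chi> {x, y} = (\<not> \<kappa>)"
      using ramsey_on_set[of R k "k - t + 1" T \<chi> \<kappa>] ramsey_number_partn unfolding R_def by blast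
    then show False
    proof cases
      case 1
      then have "has_mono W J \<chi> \<kappa> (card C)" using T by (intro clique_S) auto
      then show False using no 1(2) by simp
    next
      case 2
      \<comment> \<open>\<open>X\<close> has no clique of size \<open>k\<close> in colour
        \<open>\<kappa>\<close>, so the asymmetric arrow gives one of size \<open>t - 1\<close> in
        the other colour; together with the \<open>k - t + 1\<close> vertices of \<open>C\<close>
        this makes \<open>k\<close>.\<close>
      have "has_mono X E \<chi> (\<not> \<kappa>) a"
        using X(3)[THEN spec, of "\<not> \<kappa>"] up[of "{}" \<kappa> k] no by auto
      then have "has_mono W J \<chi> (\<not> \<kappa>) (card C + a)"
        using 2 T by (intro up) (auto simp: T_def)
      moreover have "card C + a = k" using 2(2) num(5) k by simp
      ultimately show False using no by simp
    qed
  qed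
  moreover have "\<not> ramsey_for G (disjoint_union (complete_graph k) (copies f (complete_graph t)))"
  proof
    let ?H = "disjoint_union (complete_graph k) (copies f (complete_graph t))"
    assume "ramsey_for G ?H"
    \<comment> \<open>The exhibited colouring: \<open>True\<close> on \<open>J True\<close>,
      \<open>False\<close> on the remaining edges.\<close>
    then have "has_mono_copy G (\<lambda>e. e \<in> J True) ?H" by (simp add: ramsey_for_def)
    then obtain colour \<phi> where \<phi>: "inj_on \<phi> (verts ?H)" "\<phi> ` verts ?H \<subseteq> W"
      and e: "\<forall>e\<in>edges ?H. \<phi> ` e \<in> \<Union>(range J) \<and> (\<phi> ` e \<in> J True) = colour"
      unfolding has_mono_copy_def G_def by auto
    have eJ: "\<phi> ` e \<in> J colour" if eH: "e \<in> edges ?H" for e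
    proof (cases colour)
      case True
      then show ?thesis using bspec[OF e eH] by simp
    next
      case False
      obtain d where "\<phi> ` e \<in> J d" using bspec[OF e eH] by blast
      then show ?thesis using bspec[OF e eH] False by (cases d) auto
    qed
    have clique: "clique (\<phi> ` U) (J colour) \<and> card (\<phi> ` U) = card U \<and> \<phi> ` U \<subseteq> W"
      if U: "U \<subseteq> verts ?H" "\<And>x y. x \<in> U \<Longrightarrow> y \<in> U \<Longrightarrow> x \<noteq> y \<Longrightarrow> {x, y} \<in> edges ?H" for U
    proof (intro conjI cliqueI)
      show "card (\<phi> ` U) = card U" using \<phi>(1) U(1) by (meson card_image inj_on_subset)
      show "\<phi> ` U \<subseteq> W" using \<phi>(2) U(1) by blast
      fix x y assume "x \<in> \<phi> ` U" "y \<in> \<phi> ` U" "x \<noteq> y"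
      then obtain u v where uv: "u \<in> U" "v \<in> U" "u \<noteq> v" "x = \<phi> u" "y = \<phi> v" by blast
      show "{x, y} \<in> J colour" using eJ[OF U(2)[OF uv(1-3)]] uv(4,5) by simp
    qed
    define A where "A = (Inl ` {..<k} :: (nat + nat \<times> nat) set)"
    define B where "B i = (Inr ` ({i} \<times> {..<t}) :: (nat + nat \<times> nat) set)" for i
    have verts: "verts ?H = A \<union> (\<Union>i<f. B i)"
      by (auto simp: disjoint_union_def copies_def complete_graph_def A_def B_def Plus_def)
    have A: "clique (\<phi> ` A) (J colour) \<and> card (\<phi> ` A) = card A \<and> \<phi> ` A \<subseteq> W"
    proof (rule clique)
      show "A \<subseteq> verts ?H" unfolding verts by blast
      fix x y assume "x \<in> A" "y \<in> A" "x \<noteq> y"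
      then obtain u v where uv: "u < k" "v < k" "u \<noteq> v" "x = Inl u" "y = Inl v" by (auto simp: A_def)
      then have "{x, y} = Inl ` {u, v}" "{u, v} \<in> nsets {..<k} 2" by auto
      then show "{x, y} \<in> edges ?H" by (auto simp: disjoint_union_def complete_graph_def simp del: image_insert)
    qed
    have B: "clique (\<phi> ` B i) (J colour) \<and> card (\<phi> ` B i) = card (B i) \<and> \<phi> ` B i \<subseteq> W" if i: "i < f" for i
    proof (rule clique)
      show "B i \<subseteq> verts ?H" unfolding verts using i by blast
      fix x y assume "x \<in> B i" "y \<in> B i" "x \<noteq> y"
      then obtain u v where uv: "u < t" "v < t" "u \<noteq> v" "x = Inr (i, u)" "y = Inr (i, v)" by (auto simp: B_def)
      then have "{x, y} = Inr ` Pair i ` {u, v}" "{u, v} \<in> nsets {..<t} 2" by auto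
      then have "{x, y} \<in> (`) Inr ` (\<Union>i<f. (`) (Pair i) ` nsets {..<t} 2)" using i by blast
      then show "{x, y} \<in> edges ?H" by (simp add: disjoint_union_def copies_def complete_graph_def)
    qed
    have card_A: "card A = k" by (simp add: A_def card_image)
    have card_B: "card (B i) = t" for i by (simp add: B_def card_image card_cartesian_product)
    show False
    proof (cases colour)
      case False
      then have "card (\<phi> ` A) \<le> m + 1"
        using join_clique_across[OF V(2,1), of "\<phi> ` A" False] A by (simp add: J_def W_def)
      then show False using A card_A num(4) by simp
    next
      case True
      \<comment> \<open>A \<open>True\<close> clique not inside \<open>{..<p}\<close> has at most
        \<open>a = t - 1\<close> vertices, so every component of the disjoint union must lie in the
        joined clique.\<close>
      have within: "\<phi> ` U \<subseteq> {..<p}"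
        if "clique (\<phi> ` U) (J colour) \<and> card (\<phi> ` U) = card U \<and> \<phi> ` U \<subseteq> W" "a < card U" for U
        using join_clique_within[OF V(2,1), of "\<phi> ` U" False] that True by (auto simp: J_def W_def)
      have "\<phi> ` A \<subseteq> {..<p}" using within[OF A] card_A num by simp
      moreover have "\<phi> ` B i \<subseteq> {..<p}" if "i < f" for i
        using within[OF B[OF that]] card_B num by simp
      ultimately have "\<phi> ` verts ?H \<subseteq> {..<p}" unfolding verts by blast
      then have "card (\<phi> ` verts ?H) \<le> p" using card_mono[of "{..<p}"] by fastforce
      moreover have "card (\<phi> ` verts ?H) = card (verts ?H)" using \<phi>(1) by (rule card_image)
      moreover have "card (verts ?H) = k + f * t"
        by (simp add: disjoint_union_def copies_def complete_graph_def card_Plus card_cartesian_product)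
      ultimately show False using f num(6) by (simp add: p_def R_def)
    qed
  qed
  ultimately show ?thesis unfolding ramsey_equivalent_def by blast
qed

theorem theorem2:
  fixes k t :: nat
  assumes "t \<ge> 3" and "k > t"
  shows "real (max_ramsey_copies k t) \<le> (real (ramsey_number k (k - t + 1)) - 1) / real t"
proof -
  let ?R = "ramsey_number k (k - t + 1)"
  let ?P = "\<lambda>f. ramsey_equivalent (complete_graph k)
    (disjoint_union (complete_graph k) (copies f (complete_graph t)))"
  have bound: "f * t < ?R" if "?P f" for f
    using not_ramsey_equivalent[OF assms, of f] that by (meson not_le)
  have "?P (max_ramsey_copies k t)"
    unfolding max_ramsey_copies_def
  \<comment> \<open>The value 0 qualifies and \<open>?R\<close> bounds all that qualify, so the
    greatest one exists and itself satisfies \<open>?P\<close>.\<close>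
  proof (rule GreatestI_nat[of ?P 0 ?R])
    show "?P 0" by (rule ramsey_equivalent_zero_copies)
    fix f assume "?P f"
    from bound[OF this] have "f * t < ?R" .
    moreover have "f \<le> f * t" using assms by simp
    ultimately show "f \<le> ?R" by linarith
  qed
  \<comment> \<open>The strict inequality in \<open>bound\<close> accounts for the subtracted
    1.\<close>
  from bound[OF this] have "max_ramsey_copies k t * t + 1 \<le> ?R" by simp
  then have "real (max_ramsey_copies k t) * real t + 1 \<le> real ?R"
    by (metis of_nat_1 of_nat_add of_nat_le_iff of_nat_mult)
  then show ?thesis using assms by (simp add: pos_le_divide_eq)
qed

end
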